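(* Let $B=\mathcal O_q(\mathrm F_{n+1})$ and $A=\mathcal O_q(\mathrm{SU}_{n+1})$. For $n\ge2$, the first-order differential calculus $\Omega^{(0,1)}_q(\mathrm F_{n+1})$ is not an object in ${}^A_B\mathrm{Mod}_0$; that is, $B^+\Omega^{(0,1)}_q(\mathrm F_{n+1})\ne\Omega^{(0,1)}_q(\mathrm F_{n+1})B^+$.
   Context: All algebras are over $\mathbb C$. Fix $q\in\mathbb R$, $q\ne-1,0,1$; $[a,b]_c:=ab-c\,ba$. $U_q(\mathfrak{sl}_{n+1})$ is the standard Drinfeld--Jimbo algebra with generators $E_i,F_i,K_i^{\pm1}$, $i=1,\dots,n$ ($K_iE_j=q^{a_{ij}}E_jK_i$, $K_iF_j=q^{-a_{ij}}F_jK_i$, $E_iF_j-F_jE_i=\delta_{ij}\frac{K_i-K_i^{-1}}{q-q^{-1}}$, quantum Serre relations), $\Delta(K_i)=K_i\otimes K_i$, $\Delta(E_i)=E_i\otimes K_i+1\otimes E_i$, $\Delta(F_i)=F_i\otimes1+K_i^{-1}\otimes F_i$. $A=\mathcal O_q(\mathrm{SU}_{n+1})$ is the Hopf algebra of matrix coefficients of its finite-dimensional type-1 representations, with evaluation pairing $\langle-,-\rangle$. $A^+=\ker\varepsilon$, $a^+=a-\varepsilon(a)1$. For $1\le i<j\le n+1$, $E_{ji}:=[E_{j-1},[E_{j-2},[\cdots[E_{i+1},E_i]_{q^{-1}}\cdots]_{q^{-1}}]_{q^{-1}}$, $E_{i+1,i}=E_i$; $I=\{x\in A^+\mid\langle E_{ji},x\rangle=0\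 \forall\,i<j\}$ (a right ideal of $A$); $\Lambda^{(0,1)}_q=A^+/I$. The fodc $\Omega^{(0,1)}_q(\mathrm{SU}_{n+1})=A\otimes\Lambda^{(0,1)}_q$ has left $A$-action and left $A$-coaction on the first factor, right action $(a\otimes v)c=ac_{(1)}\otimes vc_{(2)}$, and $\bar\partial a=a_{(1)}\otimes[a_{(2)}^+]$. $B=\mathcal O_q(\mathrm F_{n+1}):=\{b\in A\mid b_{(1)}\langle K_i,b_{(2)}\rangle=b,\ i=1,\dots,n\}$ is the full quantum flag manifold, $B^+=B\cap\ker\varepsilon$, and $\Omega^{(0,1)}_q(\mathrm F_{n+1})$ is the $B$-sub-bimodule of $\Omega^{(0,1)}_q(\mathrm{SU}_{n+1})$ generated by $\bar\partial B$. ${}^A_B\mathrm{Mod}_B$ is the category of left $A$-comodules $\mathcal F$ with a $B$-bimodule structure such that $\Delta_L(bfc)=\Delta(b)\Delta_L(f)\Delta(c)$, and ${}^A_B\mathrm{Mod}_0$ is its full subcategory of objects $\mathcal F$ with $B^+\mathcal F=\mathcal FB^+$. *)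

theory Defs
  imports
    "HOL-Library.Poly_Mapping"
    "HOL-Library.Product_Plus"
    "HOL-Algebra.AbelCoset"
    "HOL-Algebra.Module"
    "Jordan_Normal_Form.Matrix"
begin

section \<open>The quantized enveloping algebra\<close>

text \<open>
  The quantized enveloping algebra of sl(n+1) is presented as the free algebra \<open>falg\<close>, i.e. the
  monoid algebra of the free monoid on the letters GE i, GF i, GK i, GKi i, modulo the two-sided
  ideal \<open>uq_ideal n q\<close>; GKi i stands for the inverse of GK i.  The letters are indexed by all
  of nat, so that \<open>falg\<close> does not depend on n; the letters whose index is outside {1..n} are
  made trivial by additional relations.  Elements of the quotient are represented by elements of
  \<open>falg\<close>, and linear functionals on it are the linear functionals on \<open>falg\<close> that vanish on
  \<open>uq_ideal n q\<close>.
\<close>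

datatype gen = GE nat | GF nat | GK nat | GKi nat

datatype word = Word (letters: "gen list")

instantiation word :: monoid_add
begin
definition zero_word :: word where "0 = Word []"
definition plus_word :: "word \<Rightarrow> word \<Rightarrow> word" where "v + w = Word (letters v @ letters w)"
instance by standard (auto simp: zero_word_def plus_word_def)
end

type_synonym falg = "word \<Rightarrow>\<^sub>0 complex"

text \<open>The tensor square of \<open>falg\<close>, as the monoid algebra of the product monoid.\<close>
type_synonym falg2 = "(word \<times> word) \<Rightarrow>\<^sub>0 complex"

definition wmono :: "word \<Rightarrow> falg" where "wmono w = Poly_Mapping.single w 1"
definition scal :: "complex \<Rightarrow> falg" where "scal c = Poly_Mapping.single 0 c"
definition gE :: "nat \<Rightarrow> falg" where "gE i = wmono (Word [GE i])"
definition gF :: "nat \<Rightarrow> falg" where "gF i = wmono (Word [GF i])"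
definition gK :: "nat \<Rightarrow> falg" where "gK i = wmono (Word [GK i])"
definition gKi :: "nat \<Rightarrow> falg" where "gKi i = wmono (Word [GKi i])"

definition adjacent :: "nat \<Rightarrow> nat \<Rightarrow> bool" where
  "adjacent i j \<longleftrightarrow> j = Suc i \<or> i = Suc j"

definition cartan :: "nat \<Rightarrow> nat \<Rightarrow> int" where
  "cartan i j = (if i = j then 2 else if adjacent i j then -1 else 0)"

inductive_set uq_rels :: "nat \<Rightarrow> real \<Rightarrow> falg set" for n :: nat and q :: real where
  KKi: "i \<in> {1..n} \<Longrightarrow> gK i * gKi i - 1 \<in> uq_rels n q"
| KiK: "i \<in> {1..n} \<Longrightarrow> gKi i * gK i - 1 \<in> uq_rels n q"
| KK: "i \<in> {1..n} \<Longrightarrow> j \<in> {1..n} \<Longrightarrow> gK i * gK j - gK j * gK i \<in> uq_rels n q"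
| KE: "i \<in> {1..n} \<Longrightarrow> j \<in> {1..n} \<Longrightarrow>
    gK i * gE j - scal (of_real (q powi cartan i j)) * gE j * gK i \<in> uq_rels n q"
| KF: "i \<in> {1..n} \<Longrightarrow> j \<in> {1..n} \<Longrightarrow>
    gK i * gF j - scal (of_real (q powi (- cartan i j))) * gF j * gK i \<in> uq_rels n q"
| EF: "i \<in> {1..n} \<Longrightarrow> j \<in> {1..n} \<Longrightarrow>
    gE i * gF j - gF j * gE i
      - (if i = j then scal (of_real (1 / (q - inverse q))) * (gK i - gKi i) else 0) \<in> uq_rels n q"
| EE: "i \<in> {1..n} \<Longrightarrow> j \<in> {1..n} \<Longrightarrow> i \<noteq> j \<Longrightarrow> \<not> adjacent i j \<Longrightarrow>
    gE i * gE j - gE j * gE i \<in> uq_rels n q"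
| FF: "i \<in> {1..n} \<Longrightarrow> j \<in> {1..n} \<Longrightarrow> i \<noteq> j \<Longrightarrow> \<not> adjacent i j \<Longrightarrow>
    gF i * gF j - gF j * gF i \<in> uq_rels n q"
| serreE: "i \<in> {1..n} \<Longrightarrow> j \<in> {1..n} \<Longrightarrow> adjacent i j \<Longrightarrow>
    gE i * gE i * gE j - scal (of_real (q + inverse q)) * gE i * gE j * gE i + gE j * gE i * gE i
      \<in> uq_rels n q"
| serreF: "i \<in> {1..n} \<Longrightarrow> j \<in> {1..n} \<Longrightarrow> adjacent i j \<Longrightarrow>
    gF i * gF i * gF j - scal (of_real (q + inverse q)) * gF i * gF j * gF i + gF j * gF i * gF i
      \<in> uq_rels n q"
| triv_E: "i \<notin> {1..n} \<Longrightarrow> gE i \<in> uq_rels n q"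
| triv_F: "i \<notin> {1..n} \<Longrightarrow> gF i \<in> uq_rels n q"
| triv_K: "i \<notin> {1..n} \<Longrightarrow> gK i - 1 \<in> uq_rels n q"
| triv_Ki: "i \<notin> {1..n} \<Longrightarrow> gKi i - 1 \<in> uq_rels n q"

inductive_set uq_ideal :: "nat \<Rightarrow> real \<Rightarrow> falg set" for n :: nat and q :: real where
  zero: "0 \<in> uq_ideal n q"
| rel: "r \<in> uq_rels n q \<Longrightarrow> a * r * b \<in> uq_ideal n q"
| add: "x \<in> uq_ideal n q \<Longrightarrow> y \<in> uq_ideal n q \<Longrightarrow> x + y \<in> uq_ideal n q"

definition tens :: "falg \<Rightarrow> falg \<Rightarrow> falg2" where
  "tens x y = (\<Sum>v\<in>Poly_Mapping.keys x. \<Sum>w\<in>Poly_Mapping.keys y.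
     Poly_Mapping.single (v, w) (Poly_Mapping.lookup x v * Poly_Mapping.lookup y w))"

fun cop_gen :: "gen \<Rightarrow> falg2" where
  "cop_gen (GE i) = tens (gE i) (gK i) + tens 1 (gE i)"
| "cop_gen (GF i) = tens (gF i) 1 + tens (gKi i) (gF i)"
| "cop_gen (GK i) = tens (gK i) (gK i)"
| "cop_gen (GKi i) = tens (gKi i) (gKi i)"

text \<open>The algebra homomorphisms \<open>falg \<rightarrow> falg \<otimes> falg\<close> and \<open>falg \<rightarrow> \<complex>\<close> lifting the coproduct and
  the counit of the quotient.\<close>
definition cop :: "falg \<Rightarrow> falg2" where
  "cop x = (\<Sum>w\<in>Poly_Mapping.keys x.
     Poly_Mapping.single 0 (Poly_Mapping.lookup x w) * prod_list (map cop_gen (letters w)))"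

fun counit_gen :: "gen \<Rightarrow> complex" where
  "counit_gen (GE i) = 0"
| "counit_gen (GF i) = 0"
| "counit_gen (GK i) = 1"
| "counit_gen (GKi i) = 1"

definition counit :: "falg \<Rightarrow> complex" where
  "counit x = (\<Sum>w\<in>Poly_Mapping.keys x.
     Poly_Mapping.lookup x w * prod_list (map counit_gen (letters w)))"

text \<open>\<open>Eroot q j i\<close> is \<open>E\<^sub>j\<^sub>i\<close>, for \<open>1 \<le> i < j\<close>; it is not used for other indices.\<close>
fun Eroot :: "real \<Rightarrow> nat \<Rightarrow> nat \<Rightarrow> falg" where
  "Eroot q 0 i = 0"
| "Eroot q (Suc j) i =
     (if j = i then gE i
      else gE j * Eroot q j i - scal (of_real (inverse q)) * Eroot q j i * gE j)"


section \<open>The quantized coordinate algebra\<close>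

text \<open>Type 1 representations on \<open>\<complex>\<^sup>d\<close>: there is a basis of joint weight vectors (the columns of P)
  on which every gK i acts by integral powers of q.\<close>
definition type1_rep :: "nat \<Rightarrow> real \<Rightarrow> nat \<Rightarrow> (falg \<Rightarrow> complex mat) \<Rightarrow> bool" where
  "type1_rep n q d \<rho> \<longleftrightarrow>
     (\<forall>x. \<rho> x \<in> carrier_mat d d) \<and>
     \<rho> 1 = 1\<^sub>m d \<and>
     (\<forall>x y. \<rho> (x * y) = \<rho> x * \<rho> y) \<and>
     (\<forall>x y. \<rho> (x + y) = \<rho> x + \<rho> y) \<and>
     (\<forall>c x. \<rho> (scal c * x) = c \<cdot>\<^sub>m \<rho> x) \<and>
     (\<forall>x\<in>uq_ideal n q. \<rho> x = 0\<^sub>m d d) \<and>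
     (\<exists>P Q \<mu>. \<forall>i\<in>{1..n}.
        similar_mat_wit (\<rho> (gK i)) (mat_diag d (\<lambda>r. of_real (q powi (\<mu> i r :: int)))) P Q)"

text \<open>The evaluation pairing of x and a is \<open>a x\<close>.\<close>
type_synonym func = "falg \<Rightarrow> complex"

definition OA :: "nat \<Rightarrow> real \<Rightarrow> func set" where
  "OA n q = {(\<lambda>x. \<xi> \<bullet> (\<rho> x *\<^sub>v v)) | d \<rho> \<xi> v.
     type1_rep n q d \<rho> \<and> \<xi> \<in> carrier_vec d \<and> v \<in> carrier_vec d}"

definition fzero :: func where "fzero = (\<lambda>x. 0)"
definition fadd :: "func \<Rightarrow> func \<Rightarrow> func" where "fadd a b = (\<lambda>x. a x + b x)"
definition fsmult :: "complex \<Rightarrow> func \<Rightarrow> func" where "fsmult c a = (\<lambda>x. c * a x)"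

text \<open>Product of OA, dual to the coproduct; its unit is \<open>counit\<close>.\<close>
definition fmult :: "func \<Rightarrow> func \<Rightarrow> func" where
  "fmult a b = (\<lambda>x. \<Sum>k\<in>Poly_Mapping.keys (cop x). Poly_Mapping.lookup (cop x) k * (a (wmono (fst k)) * b (wmono (snd k))))"

text \<open>Counit of OA.\<close>
definition eps :: "func \<Rightarrow> complex" where "eps a = a 1"

text \<open>The coproduct of OA is given by \<open>a\<^sub>(\<^sub>1\<^sub>)(x) a\<^sub>(\<^sub>2\<^sub>)(y) = a (x * y)\<close>.  It is used through the
  contraction \<open>coprod a x = a\<^sub>(\<^sub>1\<^sub>)(x) a\<^sub>(\<^sub>2\<^sub>)\<close>, in accordance with the description of tensor
  products below.\<close>
definition coprod :: "func \<Rightarrow> falg \<Rightarrow> func" where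
  "coprod a x = (\<lambda>y. a (x * y))"

definition fplus :: "func \<Rightarrow> func" where
  "fplus a = (\<lambda>x. a x - eps a * counit x)"

definition OAplus :: "nat \<Rightarrow> real \<Rightarrow> func set" where
  "OAplus n q = {a \<in> OA n q. eps a = 0}"

text \<open>The full quantum flag manifold: \<open>b\<^sub>(\<^sub>1\<^sub>)(x) b\<^sub>(\<^sub>2\<^sub>)(gK i) = b x\<close>.\<close>
definition OB :: "nat \<Rightarrow> real \<Rightarrow> func set" where
  "OB n q = {b \<in> OA n q. \<forall>i\<in>{1..n}. (\<lambda>x. coprod b x (gK i)) = b}"

definition OBplus :: "nat \<Rightarrow> real \<Rightarrow> func set" where
  "OBplus n q = {b \<in> OB n q. eps b = 0}"


section \<open>Complex vector spaces and tensor products with OA\<close>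

definition complex_ring :: "complex ring" where
  "complex_ring = \<lparr>carrier = UNIV, monoid.mult = (*), one = 1, zero = 0, add = (+)\<rparr>"

text \<open>Complex vector spaces are modules over \<open>complex_ring\<close>; the ring fields \<open>mult\<close> and \<open>one\<close> of
  the module record are unused.\<close>

inductive_set lin_span :: "(complex, 'v, 'm) module_scheme \<Rightarrow> 'v set \<Rightarrow> 'v set"
  for M :: "(complex, 'v, 'm) module_scheme" (structure) and S :: "'v set" where
  zero: "\<zero> \<in> lin_span M S"
| base: "s \<in> S \<Longrightarrow> s \<in> lin_span M S"
| add: "x \<in> lin_span M S \<Longrightarrow> y \<in> lin_span M S \<Longrightarrow> x \<oplus> y \<in> lin_span M S"
| smult: "x \<in> lin_span M S \<Longrightarrow> c \<odot> x \<in> lin_span M S"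

definition func_space :: "func set \<Rightarrow> (complex, func) module" where
  "func_space S = \<lparr>carrier = S, monoid.mult = undefined, one = undefined,
     zero = fzero, add = fadd, smult = fsmult\<rparr>"

text \<open>The term \<open>N\<close> in \<open>smult\<close> makes \<open>0 \<odot> X\<close> the zero coset.\<close>
definition quot_space :: "(complex, 'v, 'm) module_scheme \<Rightarrow> 'v set \<Rightarrow> (complex, 'v set) module" where
  "quot_space M N = \<lparr>carrier = a_rcosets\<^bsub>M\<^esub> N, monoid.mult = undefined, one = undefined,
     zero = N, add = (\<lambda>X Y. X <+>\<^bsub>M\<^esub> Y),
     smult = (\<lambda>c X. N <+>\<^bsub>M\<^esub> ((\<lambda>x. c \<odot>\<^bsub>M\<^esub> x) ` X))\<rparr>"

text \<open>
  Since \<open>S\<close> consists of functionals, \<open>S \<otimes> M\<close> is the space of functions from \<open>falg\<close> to \<open>M\<close>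
  spanned by the elementary tensors \<open>a \<otimes> m\<close>, where \<open>a \<otimes> m\<close> is the function mapping x to
  \<open>a(x) m\<close>.
\<close>
definition fun_space :: "(complex, 'v, 'm) module_scheme \<Rightarrow> (complex, falg \<Rightarrow> 'v) module" where
  "fun_space M = \<lparr>carrier = {f. \<forall>x. f x \<in> carrier M}, monoid.mult = undefined, one = undefined,
     zero = (\<lambda>x. \<zero>\<^bsub>M\<^esub>), add = (\<lambda>f g x. f x \<oplus>\<^bsub>M\<^esub> g x), smult = (\<lambda>c f x. c \<odot>\<^bsub>M\<^esub> f x)\<rparr>"

definition tensor :: "func set \<Rightarrow> (complex, 'v, 'm) module_scheme \<Rightarrow> (complex, falg \<Rightarrow> 'v) module" where
  "tensor S M = (fun_space M) \<lparr>carrier :=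
     lin_span (fun_space M) {(\<lambda>x. a x \<odot>\<^bsub>M\<^esub> m) | a m. a \<in> S \<and> m \<in> carrier M}\<rparr>"

text \<open>\<open>sweedler M x g\<close> is \<open>g x\<^sub>(\<^sub>1\<^sub>) x\<^sub>(\<^sub>2\<^sub>)\<close>, for g given on monomials and extended bilinearly.\<close>
definition sweedler ::
    "(complex, 'v, 'm) module_scheme \<Rightarrow> falg \<Rightarrow> (falg \<Rightarrow> falg \<Rightarrow> 'v) \<Rightarrow> 'v" where
  "sweedler M x g = (\<Oplus>\<^bsub>M\<^esub>k\<in>Poly_Mapping.keys (cop x). Poly_Mapping.lookup (cop x) k \<odot>\<^bsub>M\<^esub> g (wmono (fst k)) (wmono (snd k)))"

text \<open>
  Actions on \<open>A \<otimes> M\<close>: \<open>b(a \<otimes> m) = ba \<otimes> m\<close>, then \<open>\<Delta>(b)(a \<otimes> m) = b\<^sub>(\<^sub>1\<^sub>)a \<otimes> b\<^sub>(\<^sub>2\<^sub>)m\<close>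
  and \<open>(a \<otimes> m)\<Delta>(c) = ac\<^sub>(\<^sub>1\<^sub>) \<otimes> mc\<^sub>(\<^sub>2\<^sub>)\<close>.  For example, the last one maps x to
  \<open>a(x\<^sub>(\<^sub>1\<^sub>)) c\<^sub>(\<^sub>1\<^sub>)(x\<^sub>(\<^sub>2\<^sub>)) mc\<^sub>(\<^sub>2\<^sub>) = (a \<otimes> m)(x\<^sub>(\<^sub>1\<^sub>)) \<cdot> coprod c x\<^sub>(\<^sub>2\<^sub>)\<close>.
\<close>
definition first_lmult ::
    "(complex, 'v, 'm) module_scheme \<Rightarrow> func \<Rightarrow> (falg \<Rightarrow> 'v) \<Rightarrow> falg \<Rightarrow> 'v" where
  "first_lmult M b f = (\<lambda>x. sweedler M x (\<lambda>y z. b y \<odot>\<^bsub>M\<^esub> f z))"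

definition diag_lmult :: "(complex, 'v, 'm) module_scheme \<Rightarrow> (func \<Rightarrow> 'v \<Rightarrow> 'v) \<Rightarrow>
    func \<Rightarrow> (falg \<Rightarrow> 'v) \<Rightarrow> falg \<Rightarrow> 'v" where
  "diag_lmult M la b f = (\<lambda>x. sweedler M x (\<lambda>y z. la (coprod b y) (f z)))"

definition diag_rmult :: "(complex, 'v, 'm) module_scheme \<Rightarrow> ('v \<Rightarrow> func \<Rightarrow> 'v) \<Rightarrow>
    (falg \<Rightarrow> 'v) \<Rightarrow> func \<Rightarrow> falg \<Rightarrow> 'v" where
  "diag_rmult M ra f c = (\<lambda>x. sweedler M x (\<lambda>y z. ra (f y) (coprod c z)))"


section \<open>Relative Hopf bimodules\<close>

record 'v hopf_bimod = "(complex, 'v) module" +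
  lact :: "func \<Rightarrow> 'v \<Rightarrow> 'v"
  ract :: "'v \<Rightarrow> func \<Rightarrow> 'v"
  coact :: "'v \<Rightarrow> falg \<Rightarrow> 'v"

definition bimodule_over :: "func set \<Rightarrow> ('v, 'm) hopf_bimod_scheme \<Rightarrow> bool" where
  "bimodule_over B M \<longleftrightarrow>
     module complex_ring M \<and>
     (\<forall>b\<in>B. \<forall>f\<in>carrier M. lact M b f \<in> carrier M \<and> ract M f b \<in> carrier M) \<and>
     (\<forall>b\<in>B. \<forall>f\<in>carrier M. \<forall>g\<in>carrier M.
        lact M b (f \<oplus>\<^bsub>M\<^esub> g) = lact M b f \<oplus>\<^bsub>M\<^esub> lact M b g \<and>
        ract M (f \<oplus>\<^bsub>M\<^esub> g) b = ract M f b \<oplus>\<^bsub>M\<^esub> ract M g b) \<and>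
     (\<forall>b\<in>B. \<forall>c\<in>B. \<forall>f\<in>carrier M.
        lact M (fadd b c) f = lact M b f \<oplus>\<^bsub>M\<^esub> lact M c f \<and>
        ract M f (fadd b c) = ract M f b \<oplus>\<^bsub>M\<^esub> ract M f c) \<and>
     (\<forall>t. \<forall>b\<in>B. \<forall>f\<in>carrier M.
        lact M (fsmult t b) f = t \<odot>\<^bsub>M\<^esub> lact M b f \<and> lact M b (t \<odot>\<^bsub>M\<^esub> f) = t \<odot>\<^bsub>M\<^esub> lact M b f \<and>
        ract M f (fsmult t b) = t \<odot>\<^bsub>M\<^esub> ract M f b \<and> ract M (t \<odot>\<^bsub>M\<^esub> f) b = t \<odot>\<^bsub>M\<^esub> ract M f b) \<and>
     (\<forall>f\<in>carrier M. lact M counit f = f \<and> ract M f counit = f) \<and>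
     (\<forall>b\<in>B. \<forall>c\<in>B. \<forall>f\<in>carrier M.
        lact M (fmult b c) f = lact M b (lact M c f) \<and>
        ract M f (fmult b c) = ract M (ract M f b) c \<and>
        ract M (lact M b f) c = lact M b (ract M f c))"

text \<open>Coassociativity and the counit axiom are stated after evaluating the factors in A at x and y.\<close>
definition left_comodule :: "func set \<Rightarrow> ('v, 'm) hopf_bimod_scheme \<Rightarrow> bool" where
  "left_comodule A M \<longleftrightarrow>
     (\<forall>f\<in>carrier M. coact M f \<in> carrier (tensor A M)) \<and>
     (\<forall>f\<in>carrier M. \<forall>g\<in>carrier M.
        coact M (f \<oplus>\<^bsub>M\<^esub> g) = coact M f \<oplus>\<^bsub>tensor A M\<^esub> coact M g) \<and>
     (\<forall>t. \<forall>f\<in>carrier M. coact M (t \<odot>\<^bsub>M\<^esub> f) = t \<odot>\<^bsub>tensor A M\<^esub> coact M f) \<and>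
     (\<forall>f\<in>carrier M. \<forall>x y. coact M f (x * y) = coact M (coact M f x) y) \<and>
     (\<forall>f\<in>carrier M. coact M f 1 = f)"

definition in_ABModB :: "nat \<Rightarrow> real \<Rightarrow> ('v, 'm) hopf_bimod_scheme \<Rightarrow> bool" where
  "in_ABModB n q M \<longleftrightarrow>
     bimodule_over (OB n q) M \<and> left_comodule (OA n q) M \<and>
     (\<forall>b\<in>OB n q. \<forall>c\<in>OB n q. \<forall>f\<in>carrier M.
        coact M (ract M (lact M b f) c) =
        diag_rmult M (ract M) (diag_lmult M (lact M) b (coact M f)) c)"

definition left_prod :: "func set \<Rightarrow> ('v, 'm) hopf_bimod_scheme \<Rightarrow> 'v set" where
  "left_prod S M = lin_span M {lact M b f | b f. b \<in> S \<and> f \<in> carrier M}"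

definition right_prod :: "('v, 'm) hopf_bimod_scheme \<Rightarrow> func set \<Rightarrow> 'v set" where
  "right_prod M S = lin_span M {ract M f b | b f. b \<in> S \<and> f \<in> carrier M}"

definition in_ABMod0 :: "nat \<Rightarrow> real \<Rightarrow> ('v, 'm) hopf_bimod_scheme \<Rightarrow> bool" where
  "in_ABMod0 n q M \<longleftrightarrow>
     in_ABModB n q M \<and> left_prod (OBplus n q) M = right_prod M (OBplus n q)"


section \<open>The first-order differential calculi\<close>

definition calc_ideal :: "nat \<Rightarrow> real \<Rightarrow> func set" where
  "calc_ideal n q = {a \<in> OAplus n q. \<forall>i j. 1 \<le> i \<and> i < j \<and> j \<le> n + 1 \<longrightarrow> a (Eroot q j i) = 0}"

definition Lam :: "nat \<Rightarrow> real \<Rightarrow> (complex, func set) module" where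
  "Lam n q = quot_space (func_space (OAplus n q)) (calc_ideal n q)"

definition cls :: "nat \<Rightarrow> real \<Rightarrow> func \<Rightarrow> func set" where
  "cls n q a = calc_ideal n q +>\<^bsub>func_space (OAplus n q)\<^esub> a"

text \<open>As \<open>calc_ideal n q\<close> is a right ideal, this is the coset of \<open>fmult x c\<close> for any x in X.\<close>
definition Lam_ract :: "nat \<Rightarrow> real \<Rightarrow> func set \<Rightarrow> func \<Rightarrow> func set" where
  "Lam_ract n q X c = calc_ideal n q <+>\<^bsub>func_space (OAplus n q)\<^esub> ((\<lambda>x. fmult x c) ` X)"

text \<open>The left coaction \<open>a \<otimes> v \<mapsto> a\<^sub>(\<^sub>1\<^sub>) \<otimes> a\<^sub>(\<^sub>2\<^sub>) \<otimes> v\<close> sends \<open>f\<close> to the function with value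
  \<open>f (x * y)\<close> at x, y.\<close>
definition Omega_SU :: "nat \<Rightarrow> real \<Rightarrow> (falg \<Rightarrow> func set) hopf_bimod" where
  "Omega_SU n q = \<lparr>carrier = carrier (tensor (OA n q) (Lam n q)),
     monoid.mult = undefined, one = undefined,
     zero = zero (tensor (OA n q) (Lam n q)),
     add = add (tensor (OA n q) (Lam n q)),
     smult = smult (tensor (OA n q) (Lam n q)),
     lact = first_lmult (Lam n q),
     ract = diag_rmult (Lam n q) (Lam_ract n q),
     coact = (\<lambda>f x y. f (x * y))\<rparr>"

text \<open>\<open>dbar n q a\<close> is \<open>a\<^sub>(\<^sub>1\<^sub>) \<otimes> [a\<^sub>(\<^sub>2\<^sub>)\<^sup>+]\<close>.\<close>
definition dbar :: "nat \<Rightarrow> real \<Rightarrow> func \<Rightarrow> falg \<Rightarrow> func set" where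
  "dbar n q a = (\<lambda>x. cls n q (fplus (coprod a x)))"

inductive_set Omega_F_carrier :: "nat \<Rightarrow> real \<Rightarrow> (falg \<Rightarrow> func set) set"
  for n :: nat and q :: real where
  dbar: "b \<in> OB n q \<Longrightarrow> dbar n q b \<in> Omega_F_carrier n q"
| add: "f \<in> Omega_F_carrier n q \<Longrightarrow> g \<in> Omega_F_carrier n q \<Longrightarrow>
    f \<oplus>\<^bsub>Omega_SU n q\<^esub> g \<in> Omega_F_carrier n q"
| smult: "f \<in> Omega_F_carrier n q \<Longrightarrow> t \<odot>\<^bsub>Omega_SU n q\<^esub> f \<in> Omega_F_carrier n q"
| lact: "b \<in> OB n q \<Longrightarrow> f \<in> Omega_F_carrier n q \<Longrightarrow>
    lact (Omega_SU n q) b f \<in> Omega_F_carrier n q"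
| ract: "b \<in> OB n q \<Longrightarrow> f \<in> Omega_F_carrier n q \<Longrightarrow>
    ract (Omega_SU n q) f b \<in> Omega_F_carrier n q"

definition Omega_F :: "nat \<Rightarrow> real \<Rightarrow> (falg \<Rightarrow> func set) hopf_bimod" where
  "Omega_F n q = (Omega_SU n q) \<lparr>carrier := Omega_F_carrier n q\<rparr>"

end

theory Submission
  imports Defs
begin

text \<open>
  Evaluating a form at \<open>1\<close>, that is, applying the counit to the first tensor factor, maps
  \<open>\<Omega>(SU)\<close> to \<open>\<Lambda> = A\<^sup>+/I\<close>.  For \<open>b \<in> B\<^sup>+\<close> the value of \<open>b f\<close> is \<open>b(1) f(1) = 0\<close>, so all of
  \<open>B\<^sup>+\<Omega>\<close> lies in the kernel of the evaluation (\<open>left_prod_at_one\<close>).  The value of \<open>f b\<close> is the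
  product of \<open>f(1)\<close> with \<open>b\<close> for the right action of \<open>A\<close> on \<open>\<Lambda>\<close> (\<open>ract_at_one\<close>); if \<open>f\<close> is the
  differential of \<open>b' \<in> B\<^sup>+\<close>, it is the class of \<open>b'b\<close>.  Hence \<open>B\<^sup>+\<Omega> = \<Omega>B\<^sup>+\<close> would force
  \<open>B\<^sup>+B\<^sup>+ \<subseteq> I\<close>.

  This fails because the root vectors are not skew primitive.  The coproduct of \<open>E\<^sub>3\<^sub>1\<close> has, besides
  \<open>E\<^sub>3\<^sub>1 \<otimes> K\<^sub>1K\<^sub>2\<close> and \<open>1 \<otimes> E\<^sub>3\<^sub>1\<close>, the middle term \<open>(1 - q\<^sup>-\<^sup>2) E\<^sub>1 \<otimes> E\<^sub>2K\<^sub>1\<close>, and since elements of \<open>B\<close> are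
  invariant under the \<open>K\<^sub>i\<close> on the right, \<open>b'b\<close> takes the value \<open>(1 - q\<^sup>-\<^sup>2) b'(E\<^sub>1) b(E\<^sub>2)\<close> at \<open>E\<^sub>3\<^sub>1\<close>
  (\<open>fmult_Eroot\<close>, \<open>OBplus_E_product\<close>).  It remains to find elements of \<open>B\<^sup>+\<close> that do not vanish at
  \<open>E\<^sub>1\<close> and \<open>E\<^sub>2\<close>, respectively.  They are matrix coefficients of the symmetric power of degree
  \<open>n + 1\<close> of the vector representation, whose monomial \<open>x\<^sub>1 \<cdots> x\<^sub>n\<^sub>+\<^sub>1\<close> has weight zero and is killed
  by none of the \<open>E\<^sub>i\<close> (\<open>ex_OBplus\<close>).

  Two facts about \<open>A\<close> make the evaluation of \<open>f b\<close> legitimate: \<open>A\<close> is closed under sums and products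
  (\<open>OA_fadd\<close>, \<open>OA_fmult\<close>), and \<open>I\<close> is a right ideal (\<open>calc_ideal_fmult\<close>).  The first needs that
  the coproduct respects all defining relations of the quantized enveloping algebra
  (\<open>ufun_fmult\<close>), the second the coproduct of every root vector.
\<close>

section \<open>Linear functionals on the free algebra\<close>

definition linext :: "('k \<Rightarrow> complex) \<Rightarrow> ('k \<Rightarrow>\<^sub>0 complex) \<Rightarrow> complex" where
  "linext c x = (\<Sum>k\<in>Poly_Mapping.keys x. Poly_Mapping.lookup x k * c k)"

lemma linext_superset:
  assumes "finite S" "Poly_Mapping.keys x \<subseteq> S"
  shows "linext c x = (\<Sum>k\<in>S. Poly_Mapping.lookup x k * c k)"
  unfolding linext_def using assms
  by (intro sum.mono_neutral_left) (auto simp: in_keys_iff)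

lemma linext_zero [simp]: "linext c 0 = 0"
  by (simp add: linext_def)

lemma linext_single [simp]: "linext c (Poly_Mapping.single k t) = t * c k"
  by (simp add: linext_def)

lemma linext_add [simp]: "linext c (x + y) = linext c x + linext c y"
proof -
  let ?S = "Poly_Mapping.keys x \<union> Poly_Mapping.keys y"
  have "linext c z = (\<Sum>k\<in>?S. Poly_Mapping.lookup z k * c k)"
    if "Poly_Mapping.keys z \<subseteq> ?S" for z
    using that by (intro linext_superset) auto
  then show ?thesis
    by (simp add: Poly_Mapping.keys_add lookup_add distrib_right sum.distrib)
qed

lemma linext_single_mult:
  fixes k :: "'k :: monoid_add"
  shows "linext c (Poly_Mapping.single k t * z) = t * linext (\<lambda>l. c (k + l)) z"
proof (induction z rule: update_induct)
  case const
  show ?case by simp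
next
  case (update f a b)
  have "Poly_Mapping.update a b f = f + Poly_Mapping.single a b"
    using update.hyps
    by (intro poly_mapping_eqI) (auto simp: lookup_add lookup_update lookup_single when_def in_keys_iff)
  with update.IH show ?case
    by (simp add: distrib_left mult_single algebra_simps)
qed

lemma linext_mult_single:
  fixes k :: "'k :: monoid_add"
  shows "linext c (z * Poly_Mapping.single k t) = t * linext (\<lambda>l. c (l + k)) z"
proof (induction z rule: update_induct)
  case const
  show ?case by simp
next
  case (update f a b)
  have "Poly_Mapping.update a b f = f + Poly_Mapping.single a b"
    using update.hyps
    by (intro poly_mapping_eqI) (auto simp: lookup_add lookup_update lookup_single when_def in_keys_iff)
  with update.IH show ?case
    by (simp add: distrib_left distrib_right mult_single algebra_simps)
qed

lemma falg_expand: "x = (\<Sum>w\<in>Poly_Mapping.keys x. scal (Poly_Mapping.lookup x w) * wmono w)"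
  by (simp add: scal_def wmono_def mult_single)
     (intro poly_mapping_eqI, simp add: lookup_sum lookup_single when_def in_keys_iff)

lemma falg_induct [case_names zero add scal word]:
  assumes "P 0" "\<And>x y. P x \<Longrightarrow> P y \<Longrightarrow> P (x + y)" "\<And>c x. P x \<Longrightarrow> P (scal c * x)"
    and "\<And>w. P (wmono w)"
  shows "P (x :: falg)"
proof -
  have "P (\<Sum>w\<in>S. scal (Poly_Mapping.lookup x w) * wmono w)" if "finite S" for S
    using that by induction (auto intro: assms)
  with falg_expand[of x] show ?thesis
    by (metis finite_keys)
qed

lemma wmono_add: "wmono (v + w) = wmono v * wmono w"
  by (simp add: wmono_def mult_single)

lemma falg_word_induct [case_names Nil Cons]:
  assumes "P 1" "\<And>g x. P x \<Longrightarrow> P (wmono (Word [g]) * x)"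
  shows "P (wmono w)"
proof (cases w)
  case (Word l)
  have "P (wmono (Word l))"
  proof (induction l)
    case Nil
    show ?case using assms(1) by (simp add: wmono_def flip: zero_word_def)
  next
    case (Cons g l)
    then have "P (wmono (Word [g]) * wmono (Word l))" by (rule assms(2))
    then show ?case by (simp add: wmono_def mult_single plus_word_def)
  qed
  with Word show ?thesis by simp
qed

lemma wmono_zero [simp]: "wmono 0 = 1"
  by (simp add: wmono_def)

lemma falg_word_rev_induct [case_names Nil snoc]:
  assumes "P 1" "\<And>g x. P x \<Longrightarrow> P (x * wmono (Word [g]))"
  shows "P (wmono w)"
proof (cases w)
  case (Word l)
  have "P (wmono (Word l))"
  proof (induction l rule: rev_induct)
    case Nil
    show ?case using assms(1) by (simp add: wmono_def flip: zero_word_def)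
  next
    case (snoc g l)
    then have "P (wmono (Word l) * wmono (Word [g]))" by (rule assms(2))
    then show ?case by (simp add: wmono_def mult_single plus_word_def)
  qed
  with Word show ?thesis by simp
qed

lemma scal_commute: "x * scal c = scal c * (x :: falg)"
proof (induction x rule: falg_induct)
  case (scal d x)
  have "scal d * scal c = scal c * scal d" by (simp add: scal_def mult_single mult.commute)
  then have "scal d * (scal c * x) = scal c * (scal d * x)" by (simp flip: mult.assoc)
  with scal show ?case by (simp add: mult.assoc)
qed (auto simp: distrib_left distrib_right scal_def wmono_def mult_single)

lemma scal_left_commute: "x * (scal c * y) = scal c * (x * (y :: falg))"
  by (metis mult.assoc scal_commute)

definition lfun :: "func \<Rightarrow> bool" where
  "lfun a \<longleftrightarrow> (\<forall>x y. a (x + y) = a x + a y) \<and> (\<forall>c x. a (scal c * x) = c * a x)"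

lemma lfun_add: "lfun a \<Longrightarrow> a (x + y) = a x + a y"
  and lfun_scal: "lfun a \<Longrightarrow> a (scal c * x) = c * a x"
  by (auto simp: lfun_def)

lemma scal_zero [simp]: "scal 0 = 0" and scal_one [simp]: "scal 1 = 1"
  by (simp_all add: scal_def)

lemma scal_minus: "scal (- c) = - scal c"
  by (simp add: scal_def single_uminus)

lemma lfun_zero: "lfun a \<Longrightarrow> a 0 = 0"
  using lfun_scal[of a 0 0] by simp

lemma lfun_minus: "lfun a \<Longrightarrow> a (- x) = - a x"
  using lfun_scal[of a "-1" x] by (simp add: scal_minus)

lemma lfun_diff: "lfun a \<Longrightarrow> a (x - y) = a x - a y"
  using lfun_add[of a x "- y"] by (simp add: lfun_minus)

lemma lfun_eqI:
  assumes "lfun a" "lfun b" "\<And>w. a (wmono w) = b (wmono w)"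
  shows "a x = b x"
  using assms(1,2)
  by (induction x rule: falg_induct) (auto simp: lfun_add lfun_zero lfun_scal assms(3))

lemma lfun_linext: "lfun (linext c)"
  unfolding lfun_def by (auto simp: scal_def linext_single_mult)

lemma lfun_lmult: "lfun a \<Longrightarrow> lfun (\<lambda>x. a (y * x))"
  unfolding lfun_def by (auto simp: distrib_left scal_left_commute)

lemma lfun_rmult: "lfun a \<Longrightarrow> lfun (\<lambda>x. a (x * y))"
  unfolding lfun_def by (auto simp: distrib_right mult.assoc)

lemma lfun_sum: "(\<And>i. i \<in> S \<Longrightarrow> lfun (a i)) \<Longrightarrow> lfun (\<lambda>x. \<Sum>i\<in>S. a i x)"
  unfolding lfun_def by (auto simp: sum.distrib sum_distrib_left)

lemma lfun_cmult: "lfun a \<Longrightarrow> lfun (\<lambda>x. c * a x)"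
  and lfun_cmult2: "lfun a \<Longrightarrow> lfun (\<lambda>x. a x * c)"
  and lfun_plus: "lfun a \<Longrightarrow> lfun b \<Longrightarrow> lfun (\<lambda>x. a x + b x)"
  unfolding lfun_def by (auto simp: algebra_simps)


section \<open>The product of functionals\<close>

definition pairing :: "func \<Rightarrow> func \<Rightarrow> falg2 \<Rightarrow> complex" where
  "pairing a b = linext (\<lambda>k. a (wmono (fst k)) * b (wmono (snd k)))"

definition rcoprod :: "func \<Rightarrow> falg \<Rightarrow> func" where
  "rcoprod a y = (\<lambda>x. a (x * y))"

abbreviation cop_word :: "word \<Rightarrow> falg2" where
  "cop_word w \<equiv> prod_list (map cop_gen (letters w))"

lemma linext_cop: "linext c (cop x) = linext (\<lambda>w. linext c (cop_word w)) x"
proof -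
  have "linext c (\<Sum>w\<in>S. h w) = (\<Sum>w\<in>S. linext c (h w))" if "finite S" for S :: "word set" and h
    using that by induction auto
  then show ?thesis
    unfolding cop_def by (simp add: linext_def[of _ x] linext_single_mult del: zero_prod_def)
qed

lemma fmult_pairing: "fmult a b = linext (\<lambda>w. pairing a b (cop_word w))"
  unfolding pairing_def linext_cop[symmetric] by (rule ext) (simp add: fmult_def linext_def)

lemma lfun_fmult: "lfun (fmult a b)"
  by (simp add: fmult_pairing lfun_linext)

lemma fmult_word: "fmult a b (wmono w) = pairing a b (cop_word w)"
  by (simp add: fmult_pairing wmono_def)

lemma pairing_add: "pairing a b (x + y) = pairing a b x + pairing a b y"
  by (simp add: pairing_def)

lemma pairing_tens_mult:
  "pairing a b (tens (wmono v) (wmono w) * z) = pairing (coprod a (wmono v)) (coprod b (wmono w)) z"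
  by (simp add: pairing_def tens_def wmono_def coprod_def linext_single_mult mult_single)

lemma pairing_mult_tens:
  "pairing a b (z * tens (wmono v) (wmono w)) = pairing (rcoprod a (wmono v)) (rcoprod b (wmono w)) z"
  by (simp add: pairing_def tens_def wmono_def rcoprod_def linext_mult_single mult_single)

lemma coprod_one [simp]: "coprod a 1 = a" and rcoprod_one [simp]: "rcoprod a 1 = a"
  by (simp_all add: coprod_def rcoprod_def)

lemma fmult_one [simp]: "fmult a b 1 = a 1 * b 1"
proof -
  have "linext c (1 :: falg2) = c 0" for c
    by (simp flip: single_one)
  moreover have "letters 0 = []"
    by (simp add: zero_word_def)
  ultimately show ?thesis
    using fmult_word[of a b 0] by (simp add: pairing_def)
qed

text \<open>
  Each generator has a coproduct with at most two elementary tensors.  Multiplication of the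
  argument by a generator can therefore be traded for translating the two functionals, which
  reduces every later computation with \<open>fmult\<close> to values of the factors.
\<close>
lemma fmult_gen_mult:
  assumes "\<And>a b z. pairing a b (cop_gen g * z) = (\<Sum>(v, w)\<leftarrow>T. pairing (coprod a v) (coprod b w) z)"
  shows "fmult a b (wmono (Word [g]) * x) = (\<Sum>(v, w)\<leftarrow>T. fmult (coprod a v) (coprod b w) x)"
proof (rule lfun_eqI[of "\<lambda>x. fmult a b (wmono (Word [g]) * x)"])
  show "lfun (\<lambda>x. fmult a b (wmono (Word [g]) * x))"
    by (intro lfun_lmult lfun_fmult)
  have "lfun (\<lambda>x. 0)" by (simp add: lfun_def)
  then show "lfun (\<lambda>x. \<Sum>(v, w)\<leftarrow>T. fmult (coprod a v) (coprod b w) x)"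
    by (induction T) (auto intro!: lfun_plus lfun_fmult)
next
  fix w
  have "wmono (Word [g]) * wmono w = wmono (Word (g # letters w))"
    by (simp add: plus_word_def flip: wmono_add)
  then show "fmult a b (wmono (Word [g]) * wmono w) =
      (\<Sum>(v, u)\<leftarrow>T. fmult (coprod a v) (coprod b u) (wmono w))"
    by (simp add: fmult_word assms)
qed

lemma fmult_mult_gen:
  assumes "\<And>a b z. pairing a b (z * cop_gen g) = (\<Sum>(v, w)\<leftarrow>T. pairing (rcoprod a v) (rcoprod b w) z)"
  shows "fmult a b (x * wmono (Word [g])) = (\<Sum>(v, w)\<leftarrow>T. fmult (rcoprod a v) (rcoprod b w) x)"
proof (rule lfun_eqI[of "\<lambda>x. fmult a b (x * wmono (Word [g]))"])
  show "lfun (\<lambda>x. fmult a b (x * wmono (Word [g])))"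
    by (intro lfun_rmult lfun_fmult)
  have "lfun (\<lambda>x. 0)" by (simp add: lfun_def)
  then show "lfun (\<lambda>x. \<Sum>(v, w)\<leftarrow>T. fmult (rcoprod a v) (rcoprod b w) x)"
    by (induction T) (auto intro!: lfun_plus lfun_fmult)
next
  fix w
  have "wmono w * wmono (Word [g]) = wmono (Word (letters w @ [g]))"
    by (simp add: plus_word_def flip: wmono_add)
  then show "fmult a b (wmono w * wmono (Word [g])) =
      (\<Sum>(v, u)\<leftarrow>T. fmult (rcoprod a v) (rcoprod b u) (wmono w))"
    by (simp add: fmult_word assms)
qed

lemma tens_one_left: "tens 1 y = tens (wmono 0) y" and tens_one_right: "tens x 1 = tens x (wmono 0)"
  by simp_all

lemmas gen_defs = gE_def gF_def gK_def gKi_def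

lemma fmult_lgen:
  "fmult a b (gE i * x) = fmult (coprod a (gE i)) (coprod b (gK i)) x + fmult a (coprod b (gE i)) x"
  "fmult a b (gF i * x) = fmult (coprod a (gF i)) b x + fmult (coprod a (gKi i)) (coprod b (gF i)) x"
  "fmult a b (gK i * x) = fmult (coprod a (gK i)) (coprod b (gK i)) x"
  "fmult a b (gKi i * x) = fmult (coprod a (gKi i)) (coprod b (gKi i)) x"
  using fmult_gen_mult[of "GE i" "[(gE i, gK i), (1, gE i)]" a b x]
    fmult_gen_mult[of "GF i" "[(gF i, 1), (gKi i, gF i)]" a b x]
    fmult_gen_mult[of "GK i" "[(gK i, gK i)]" a b x]
    fmult_gen_mult[of "GKi i" "[(gKi i, gKi i)]" a b x]
  by (auto simp: gen_defs tens_one_left tens_one_right distrib_right pairing_add pairing_tens_mult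
      simp del: wmono_zero)
     (auto)

lemma fmult_rgen:
  "fmult a b (x * gE i) = fmult (rcoprod a (gE i)) (rcoprod b (gK i)) x + fmult a (rcoprod b (gE i)) x"
  "fmult a b (x * gF i) = fmult (rcoprod a (gF i)) b x + fmult (rcoprod a (gKi i)) (rcoprod b (gF i)) x"
  "fmult a b (x * gK i) = fmult (rcoprod a (gK i)) (rcoprod b (gK i)) x"
  "fmult a b (x * gKi i) = fmult (rcoprod a (gKi i)) (rcoprod b (gKi i)) x"
  using fmult_mult_gen[of "GE i" "[(gE i, gK i), (1, gE i)]" a b x]
    fmult_mult_gen[of "GF i" "[(gF i, 1), (gKi i, gF i)]" a b x]
    fmult_mult_gen[of "GK i" "[(gK i, gK i)]" a b x]
    fmult_mult_gen[of "GKi i" "[(gKi i, gKi i)]" a b x]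
  by (auto simp: gen_defs tens_one_left tens_one_right distrib_left pairing_add pairing_mult_tens
      simp del: wmono_zero)
     (auto)

lemma fmult_gen:
  "fmult a b (gE i) = a (gE i) * b (gK i) + a 1 * b (gE i)"
  "fmult a b (gF i) = a (gF i) * b 1 + a (gKi i) * b (gF i)"
  "fmult a b (gK i) = a (gK i) * b (gK i)"
  "fmult a b (gKi i) = a (gKi i) * b (gKi i)"
  using fmult_lgen[of a b i 1] by (simp_all add: coprod_def)


section \<open>Functionals on the quantized enveloping algebra\<close>

lemma uq_ideal_rel: "r \<in> uq_rels n q \<Longrightarrow> r \<in> uq_ideal n q"
  using uq_ideal.rel[of r n q 1 1] by simp

lemma uq_ideal_lmult: "x \<in> uq_ideal n q \<Longrightarrow> y * x \<in> uq_ideal n q"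
proof (induction rule: uq_ideal.induct)
  case (rel r a b)
  then show ?case using uq_ideal.rel[of r n q "y * a" b] by (simp add: mult.assoc)
qed (auto simp: distrib_left intro: uq_ideal.intros)

lemma uq_ideal_rmult: "x \<in> uq_ideal n q \<Longrightarrow> x * y \<in> uq_ideal n q"
proof (induction rule: uq_ideal.induct)
  case (rel r a b)
  then show ?case using uq_ideal.rel[of r n q a "b * y"] by (simp add: mult.assoc)
qed (auto simp: distrib_right intro: uq_ideal.intros)

lemma uq_ideal_minus: "x \<in> uq_ideal n q \<Longrightarrow> - x \<in> uq_ideal n q"
  using uq_ideal_lmult[of x n q "- 1"] by simp

definition ucong :: "nat \<Rightarrow> real \<Rightarrow> falg \<Rightarrow> falg \<Rightarrow> bool" where
  "ucong n q x y \<longleftrightarrow> x - y \<in> uq_ideal n q"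

lemma ucong_refl [simp]: "ucong n q x x"
  by (simp add: ucong_def uq_ideal.zero)

lemma ucong_sym: "ucong n q x y \<Longrightarrow> ucong n q y x"
  unfolding ucong_def using uq_ideal_minus by fastforce

lemma ucong_trans [trans]: "ucong n q x y \<Longrightarrow> ucong n q y z \<Longrightarrow> ucong n q x z"
  unfolding ucong_def using uq_ideal.add[of "x - y" n q "y - z"] by simp

lemma ucong_add: "ucong n q x y \<Longrightarrow> ucong n q x' y' \<Longrightarrow> ucong n q (x + x') (y + y')"
  unfolding ucong_def using uq_ideal.add[of "x - y" n q "x' - y'"] by (simp add: algebra_simps)

lemma ucong_lmult: "ucong n q x y \<Longrightarrow> ucong n q (z * x) (z * y)"
  unfolding ucong_def using uq_ideal_lmult[of "x - y" n q z] by (simp add: right_diff_distrib)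

lemma ucong_rmult: "ucong n q x y \<Longrightarrow> ucong n q (x * z) (y * z)"
  unfolding ucong_def using uq_ideal_rmult[of "x - y" n q z] by (simp add: left_diff_distrib)

lemma ucong_diff: "ucong n q x y \<Longrightarrow> ucong n q x' y' \<Longrightarrow> ucong n q (x - x') (y - y')"
  using ucong_add[of n q x y "- 1 * x'" "- 1 * y'"] ucong_lmult[of n q x' y' "- 1"] by simp

text \<open>
  The linear functionals on the quantized enveloping algebra itself, that is, on the quotient of
  the free algebra by the ideal of relations.
\<close>
definition ufun :: "nat \<Rightarrow> real \<Rightarrow> func \<Rightarrow> bool" where
  "ufun n q a \<longleftrightarrow> lfun a \<and> (\<forall>x\<in>uq_ideal n q. a x = 0)"

lemma ufun_lfun: "ufun n q a \<Longrightarrow> lfun a"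
  by (simp add: ufun_def)

lemma ufun_cong: "ufun n q a \<Longrightarrow> ucong n q x y \<Longrightarrow> a x = a y"
  unfolding ufun_def ucong_def by (metis eq_iff_diff_eq_0 lfun_diff)

lemma ufun_coprod: "ufun n q a \<Longrightarrow> ufun n q (coprod a y)"
  by (auto simp: ufun_def coprod_def lfun_lmult uq_ideal_lmult)

lemma ufun_rcoprod: "ufun n q a \<Longrightarrow> ufun n q (rcoprod a y)"
  by (auto simp: ufun_def rcoprod_def lfun_rmult uq_ideal_rmult)

definition qpow :: "real \<Rightarrow> int \<Rightarrow> complex" where
  "qpow q k = of_real (q powi k)"

lemma qpow_0 [simp]: "qpow q 0 = 1" and qpow_1: "qpow q 1 = of_real q"
  by (simp_all add: qpow_def)

lemma qpow_add: "q \<noteq> 0 \<Longrightarrow> qpow q (k + l) = qpow q k * qpow q l"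
  by (simp add: qpow_def power_int_add)

lemma qpow_minus: "qpow q (- k) = inverse (qpow q k)"
  by (simp add: qpow_def power_int_minus of_real_inverse)

lemma qpow_nonzero: "q \<noteq> 0 \<Longrightarrow> qpow q k \<noteq> 0"
  by (simp add: qpow_def)

lemma cartan_sym: "cartan i j = cartan j i"
  by (auto simp: cartan_def adjacent_def)

lemma scal_mult: "scal (c * d) = scal c * scal d"
  by (simp add: scal_def mult_single)

lemma scal_cancel': "c \<noteq> 0 \<Longrightarrow> scal (inverse c) * (scal c * x) = x"
  by (simp flip: mult.assoc scal_mult)

lemma ucong_KKi: "i \<in> {1..n} \<Longrightarrow> ucong n q (gK i * gKi i) 1"
  and ucong_KiK: "i \<in> {1..n} \<Longrightarrow> ucong n q (gKi i * gK i) 1"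
  and ucong_KK: "i \<in> {1..n} \<Longrightarrow> j \<in> {1..n} \<Longrightarrow> ucong n q (gK i * gK j) (gK j * gK i)"
  and ucong_KE: "i \<in> {1..n} \<Longrightarrow> j \<in> {1..n} \<Longrightarrow>
    ucong n q (gK i * gE j) (scal (qpow q (cartan i j)) * (gE j * gK i))"
  and ucong_KF: "i \<in> {1..n} \<Longrightarrow> j \<in> {1..n} \<Longrightarrow>
    ucong n q (gK i * gF j) (scal (qpow q (- cartan i j)) * (gF j * gK i))"
  using uq_rels.KKi[of i n q] uq_rels.KiK[of i n q] uq_rels.KK[of i n j q] uq_rels.KE[of i n j q]
    uq_rels.KF[of i n j q]
  by (simp_all add: ucong_def uq_ideal_rel qpow_def mult.assoc)

text \<open>
  Conjugation: commuting with \<open>K\<^sub>i\<close> up to a scalar passes to the inverse of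
  \<open>K\<^sub>i\<close> with the inverse scalar.
\<close>
lemma ucong_Ki_move:
  assumes i: "i \<in> {1..n}" and c: "c \<noteq> 0" and K: "ucong n q (gK i * x) (scal c * (x * gK i))"
  shows "ucong n q (gKi i * x) (scal (inverse c) * (x * gKi i))"
proof -
  have "ucong n q (gKi i * x) (gKi i * x * (gK i * gKi i))"
    using ucong_lmult[OF ucong_KKi[OF i, of q], of "gKi i * x"] by (simp add: ucong_sym)
  also have "gKi i * x * (gK i * gKi i) = scal (inverse c) * (gKi i * (scal c * (x * gK i)) * gKi i)"
    by (subst scal_left_commute) (simp add: mult.assoc scal_cancel' c)
  also have "ucong n q \<dots> (scal (inverse c) * (gKi i * (gK i * x) * gKi i))"
    by (intro ucong_lmult ucong_rmult ucong_sym[OF K])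
  also have "\<dots> = scal (inverse c) * ((gKi i * gK i) * (x * gKi i))"
    by (simp add: mult.assoc)
  also have "ucong n q \<dots> (scal (inverse c) * (1 * (x * gKi i)))"
    by (intro ucong_lmult ucong_rmult ucong_KiK i)
  finally show ?thesis by simp
qed

lemma ucong_KiE: "q \<noteq> 0 \<Longrightarrow> i \<in> {1..n} \<Longrightarrow> j \<in> {1..n} \<Longrightarrow>
    ucong n q (gKi i * gE j) (scal (qpow q (- cartan i j)) * (gE j * gKi i))"
  and ucong_KiF: "q \<noteq> 0 \<Longrightarrow> i \<in> {1..n} \<Longrightarrow> j \<in> {1..n} \<Longrightarrow>
    ucong n q (gKi i * gF j) (scal (qpow q (cartan i j)) * (gF j * gKi i))"
  and ucong_KiK_commute: "i \<in> {1..n} \<Longrightarrow> j \<in> {1..n} \<Longrightarrow> ucong n q (gKi i * gK j) (gK j * gKi i)"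
  using ucong_Ki_move[OF _ _ ucong_KE, of i n q j] ucong_Ki_move[OF _ _ ucong_KF, of i n q j]
    ucong_Ki_move[of i n 1 q "gK j"] ucong_KK[of i n j q]
  by (simp_all add: qpow_nonzero qpow_minus)

lemma ucong_KiKi:
  assumes "i \<in> {1..n}" "j \<in> {1..n}"
  shows "ucong n q (gKi i * gKi j) (gKi j * gKi i)"
  using ucong_Ki_move[of i n 1 q "gKi j"] assms ucong_sym[OF ucong_KiK_commute[of j n i q]] by simp

text \<open>
  A functional on the quotient does not see the difference between congruent elements, also when
  they occur inside a longer product.  The positions listed are those in a word of length three,
  the longest that the relations involve.
\<close>
lemma ufun_rewrite:
  assumes "ucong n q (x * y) (scal c * (y' * x'))" "ufun n q a"
  shows "a (x * y) = c * a (y' * x')"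
    "a (x * (y * z)) = c * a (y' * (x' * z))"
    "a (w * (x * y)) = c * a (w * (y' * x'))"
proof -
  have "b (x * y) = c * b (y' * x')" if "ufun n q b" for b
    using ufun_cong[OF that assms(1)] that by (simp add: lfun_scal ufun_lfun)
  from this[OF assms(2)] this[OF ufun_rcoprod, OF assms(2), of z]
    this[OF ufun_coprod, OF assms(2), of w]
  show "a (x * y) = c * a (y' * x')"
    "a (x * (y * z)) = c * a (y' * (x' * z))"
    "a (w * (x * y)) = c * a (w * (y' * x'))"
    by (simp_all add: coprod_def rcoprod_def mult.assoc)
qed

lemma ufun_rewrite1:
  assumes "ucong n q (x * y) (y' * x')" "ufun n q a"
  shows "a (x * y) = a (y' * x')"
    "a (x * (y * z)) = a (y' * (x' * z))"
    "a (w * (x * y)) = a (w * (y' * x'))"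
  using ufun_rewrite[of n q x y 1 y' x' a] assms by simp_all

lemma ufun_rel: "ufun n q a \<Longrightarrow> r \<in> uq_rels n q \<Longrightarrow> a r = 0"
  by (simp add: ufun_def uq_ideal_rel)

lemma fmult_diff: "fmult a b (x - y) = fmult a b x - fmult a b y"
  and fmult_add: "fmult a b (x + y) = fmult a b x + fmult a b y"
  and fmult_scal: "fmult a b (scal c * x) = c * fmult a b x"
  by (simp_all add: lfun_diff lfun_add lfun_scal lfun_fmult)

lemmas fmult_expand = fmult_diff fmult_add fmult_scal fmult_lgen fmult_gen coprod_def mult.assoc

lemma qpow_special: "q \<noteq> 0 \<Longrightarrow> qpow q 2 = of_real q ^ 2" "qpow q (-1) = inverse (of_real q)"
  "qpow q (-2) = inverse (of_real q) ^ 2"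
  by (simp_all add: qpow_def power_int_minus power_inverse)

text \<open>
  The coproduct of \<open>E\<^sub>i\<close> is \<open>X\<^sub>i + Y\<^sub>i\<close> with
  \<open>X\<^sub>i = E\<^sub>i \<otimes> K\<^sub>i\<close> and \<open>Y\<^sub>i = 1 \<otimes>
  E\<^sub>i\<close>.  The pure terms of the Serre relation for \<open>X + Y\<close> vanish by the
  Serre relations of the two factors.  For the mixed terms the \<open>K\<close>'s in the right
  factor are moved to the end; every word then appears with coefficient \<open>q\<^sup>2 - (q +
  q\<^sup>-\<^sup>1) q + 1 = 0\<close> or a variant of it.
\<close>
lemma fmult_serreE:
  assumes q: "q \<noteq> 0" and a: "ufun n q a" and b: "ufun n q b"
    and ij: "i \<in> {1..n}" "j \<in> {1..n}" "adjacent i j"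
  shows "fmult a b (gE i * gE i * gE j - scal (of_real (q + inverse q)) * gE i * gE j * gE i
    + gE j * gE i * gE i) = 0"
proof -
  let ?c = "of_real (q + inverse q) :: complex"
  have neq: "i \<noteq> j" "adjacent j i" using ij(3) by (auto simp: adjacent_def)
  have cart: "cartan i i = 2" "cartan j j = 2" "cartan i j = -1" "cartan j i = -1"
    using neq ij(3) by (auto simp: cartan_def)
  \<comment> \<open>rewriting moves the \<open>K\<close>'s in the right factor behind the \<open>E\<close>'s\<close>
  note sw = ufun_rewrite1[OF ucong_KK[OF ij(2,1)] b] ufun_rewrite[OF ucong_KE[OF ij(1,1)] b]
    ufun_rewrite[OF ucong_KE[OF ij(1,2)] b] ufun_rewrite[OF ucong_KE[OF ij(2,1)] b]
    ufun_rewrite[OF ucong_KE[OF ij(2,2)] b]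
  have s: "f (gE i * (gE i * gE j)) = ?c * f (gE i * (gE j * gE i)) - f (gE j * (gE i * gE i))"
    if "ufun n q f" for f
    using ufun_rel[OF that serreE[OF ij]] ufun_lfun[OF that]
    by (simp add: lfun_add lfun_diff lfun_scal mult.assoc algebra_simps)
  show ?thesis
    apply (simp add: fmult_expand s[OF a] s[OF b] sw cart qpow_special q)
    using q by (simp add: field_simps power2_eq_square)
qed


text \<open>
  As for the \<open>E\<close>'s, with the roles of the two tensor factors exchanged: the inverses
  of the \<open>K\<close>'s stand in the left factor.
\<close>
lemma fmult_serreF:
  assumes q: "q \<noteq> 0" and a: "ufun n q a" and b: "ufun n q b"
    and ij: "i \<in> {1..n}" "j \<in> {1..n}" "adjacent i j"
  shows "fmult a b (gF i * gF i * gF j - scal (of_real (q + inverse q)) * gF i * gF j * gF i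
    + gF j * gF i * gF i) = 0"
proof -
  let ?c = "of_real (q + inverse q) :: complex"
  have neq: "i \<noteq> j" "adjacent j i" using ij(3) by (auto simp: adjacent_def)
  have cart: "cartan i i = 2" "cartan j j = 2" "cartan i j = -1" "cartan j i = -1"
    using neq ij(3) by (auto simp: cartan_def)
  note sw = ufun_rewrite1[OF ucong_KiKi[OF ij(2,1)] a] ufun_rewrite[OF ucong_KiF[OF q ij(1,1)] a]
    ufun_rewrite[OF ucong_KiF[OF q ij(1,2)] a] ufun_rewrite[OF ucong_KiF[OF q ij(2,1)] a]
    ufun_rewrite[OF ucong_KiF[OF q ij(2,2)] a]
  have s: "f (gF i * (gF i * gF j)) = ?c * f (gF i * (gF j * gF i)) - f (gF j * (gF i * gF i))"
    if "ufun n q f" for f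
    using ufun_rel[OF that serreF[OF ij]] ufun_lfun[OF that]
    by (simp add: lfun_add lfun_diff lfun_scal mult.assoc algebra_simps)
  show ?thesis
    apply (simp add: fmult_expand s[OF a] s[OF b] sw cart qpow_special q)
    using q by (simp add: field_simps power2_eq_square)
qed

text \<open>
  The mixed terms \<open>E\<^sub>iK\<^sub>j\<^sup>-\<^sup>1 \<otimes> K\<^sub>iF\<^sub>j\<close>
  and \<open>K\<^sub>j\<^sup>-\<^sup>1E\<^sub>i \<otimes> F\<^sub>jK\<^sub>i\<close> cancel, since
  the two scalars from moving the \<open>K\<close>'s agree; the other terms are the relation in
  one tensor factor.
\<close>
lemma fmult_EF:
  assumes q: "q \<noteq> 0" and a: "ufun n q a" and b: "ufun n q b"
    and ij: "i \<in> {1..n}" "j \<in> {1..n}"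
  shows "fmult a b (gE i * gF j - gF j * gE i
      - (if i = j then scal (of_real (1 / (q - inverse q))) * (gK i - gKi i) else 0)) = 0"
proof -
  let ?c = "if i = j then of_real (1 / (q - inverse q)) else 0 :: complex"
  have s: "f (gE i * gF j) = f (gF j * gE i) + ?c * (f (gK i) - f (gKi i))" if "ufun n q f" for f
    using ufun_rel[OF that EF[OF ij]] ufun_lfun[OF that]
    by (cases "i = j") (simp_all add: lfun_add lfun_diff lfun_scal diff_divide_distrib algebra_simps)
  note sw = ufun_rewrite(1)[OF ucong_KiE[OF q ij(2,1)] a] ufun_rewrite(1)[OF ucong_KF[OF ij] b]
  show ?thesis
  proof (cases "i = j")
    case True
    show ?thesis
      using sw q unfolding True
      by (simp add: fmult_expand s[OF a, unfolded True] s[OF b, unfolded True] qpow_minus qpow_nonzero diff_divide_distrib algebra_simps)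
  next
    case False
    then show ?thesis
      using sw s[OF a] s[OF b] q
      by (simp add: fmult_expand cartan_sym[of j i] qpow_minus qpow_nonzero algebra_simps)
  qed
qed

lemma fmult_rel:
  assumes q: "q \<noteq> 0" and a: "ufun n q a" and b: "ufun n q b" and "r \<in> uq_rels n q"
  shows "fmult a b r = 0"
  using assms(4)
proof cases
  case (KKi i)
  then show ?thesis using ufun_cong[OF a ucong_KKi, of i] ufun_cong[OF b ucong_KKi, of i]
    by (simp add: fmult_expand)
next
  case (KiK i)
  then show ?thesis using ufun_cong[OF a ucong_KiK, of i] ufun_cong[OF b ucong_KiK, of i]
    by (simp add: fmult_expand)
next
  case (KK i j)
  then show ?thesis using ufun_cong[OF a ucong_KK, of i j] ufun_cong[OF b ucong_KK, of i j]
    by (simp add: fmult_expand)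
next
  case (KE i j)
  then show ?thesis unfolding KE(1) qpow_def[symmetric]
    using ufun_rewrite(1)[OF ucong_KE a, of i j] ufun_rewrite(1)[OF ucong_KE b, of i j]
      ufun_cong[OF b ucong_KK, of i j]
    by (simp add: fmult_expand algebra_simps)
next
  case (KF i j)
  then show ?thesis unfolding KF(1) qpow_def[symmetric]
    using ufun_rewrite(1)[OF ucong_KF a, of i j] ufun_rewrite(1)[OF ucong_KF b, of i j]
      ufun_cong[OF a ucong_KiK_commute, of j i]
    by (simp add: fmult_expand algebra_simps)
next
  case (EF i j)
  then show ?thesis using fmult_EF[OF q a b, of i j] by simp
next
  case (EE i j)
  then have "cartan i j = 0" "cartan j i = 0"
    by (auto simp: cartan_def adjacent_def)
  moreover have s: "f (gE i * gE j) = f (gE j * gE i)" if "ufun n q f" for f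
    using ufun_rel[OF that uq_rels.EE[OF EE(2-5)]] ufun_lfun[OF that] by (simp add: lfun_diff)
  ultimately show ?thesis
    using EE s[OF a] s[OF b] ufun_rewrite(1)[OF ucong_KE b, of i j] ufun_rewrite(1)[OF ucong_KE b, of j i]
      ufun_cong[OF b ucong_KK, of i j]
    by (simp add: fmult_expand)
next
  case (FF i j)
  then have "cartan i j = 0" "cartan j i = 0"
    by (auto simp: cartan_def adjacent_def)
  moreover have s: "f (gF i * gF j) = f (gF j * gF i)" if "ufun n q f" for f
    using ufun_rel[OF that uq_rels.FF[OF FF(2-5)]] ufun_lfun[OF that] by (simp add: lfun_diff)
  ultimately show ?thesis
    using FF s[OF a] s[OF b] ufun_rewrite(1)[OF ucong_KiF[OF q] a, of i j] ufun_rewrite(1)[OF ucong_KiF[OF q] a, of j i]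
      ufun_cong[OF a ucong_KiKi, of i j]
    by (simp add: fmult_expand)
next
  case (serreE i j)
  then show ?thesis using fmult_serreE[OF q a b] by simp
next
  case (serreF i j)
  then show ?thesis using fmult_serreF[OF q a b] by simp
next
  case (triv_E i)
  then show ?thesis using ufun_rel[OF a uq_rels.triv_E[OF triv_E(2)]] ufun_rel[OF b uq_rels.triv_E[OF triv_E(2)]]
    by (simp add: fmult_gen)
next
  case (triv_F i)
  then show ?thesis using ufun_rel[OF a uq_rels.triv_F[OF triv_F(2)]] ufun_rel[OF b uq_rels.triv_F[OF triv_F(2)]]
    by (simp add: fmult_gen)
next
  case (triv_K i)
  then show ?thesis using ufun_rel[OF a uq_rels.triv_K[OF triv_K(2)]] ufun_rel[OF b uq_rels.triv_K[OF triv_K(2)]]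
    a b by (simp add: fmult_gen fmult_diff lfun_diff ufun_lfun)
next
  case (triv_Ki i)
  then show ?thesis using ufun_rel[OF a uq_rels.triv_Ki[OF triv_Ki(2)]] ufun_rel[OF b uq_rels.triv_Ki[OF triv_Ki(2)]]
    a b by (simp add: fmult_gen fmult_diff lfun_diff ufun_lfun)
qed

lemma wmono_gen:
  "wmono (Word [GE i]) = gE i" "wmono (Word [GF i]) = gF i"
  "wmono (Word [GK i]) = gK i" "wmono (Word [GKi i]) = gKi i"
  by (simp_all add: gen_defs)

lemma fmult_annihilates_lmult:
  assumes "\<And>a b. ufun n q a \<Longrightarrow> ufun n q b \<Longrightarrow> fmult a b z = 0"
    and "ufun n q a" "ufun n q b"
  shows "fmult a b (x * z) = 0"
  using assms(2,3)
proof (induction x arbitrary: a b rule: falg_induct)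
  case (word w)
  then show ?case
  proof (induction w arbitrary: a b rule: falg_word_induct)
    case Nil
    then show ?case using assms(1) by simp
  next
    case (Cons g x)
    then show ?case
      by (cases g) (simp_all add: wmono_gen mult.assoc fmult_lgen ufun_coprod)
  qed
qed (simp_all add: distrib_right fmult_add lfun_zero lfun_fmult mult.assoc fmult_scal)

lemma fmult_annihilates_rmult:
  assumes "\<And>a b. ufun n q a \<Longrightarrow> ufun n q b \<Longrightarrow> fmult a b z = 0"
    and "ufun n q a" "ufun n q b"
  shows "fmult a b (z * x) = 0"
proof -
  have "fmult a b (z * wmono w) = 0" if "ufun n q a" "ufun n q b" for a b w
    using that
  proof (induction w arbitrary: a b rule: falg_word_rev_induct)
    case Nil
    then show ?case using assms(1) by simp
  next
    case (snoc g x)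
    then show ?case
      by (cases g) (simp_all add: wmono_gen fmult_rgen ufun_rcoprod flip: mult.assoc)
  qed
  then show ?thesis using assms(2,3)
    by (induction x rule: falg_induct)
      (simp_all add: distrib_left fmult_add lfun_zero lfun_fmult scal_left_commute fmult_scal)
qed

text \<open>
  The ideal of relations is a coideal: it suffices to test the relations themselves, because
  translating the two functionals by generators absorbs the words to their left and right.
\<close>
lemma ufun_fmult:
  assumes q: "q \<noteq> 0" and a: "ufun n q a" and b: "ufun n q b"
  shows "ufun n q (fmult a b)"
  unfolding ufun_def
proof (intro conjI ballI)
  show "lfun (fmult a b)" by (rule lfun_fmult)
  fix x assume "x \<in> uq_ideal n q"
  then show "fmult a b x = 0"
  proof induction
    case (rel r x y)
    show ?case
      by (intro fmult_annihilates_rmult[OF _ a b] fmult_annihilates_lmult) (use rel fmult_rel[OF q] in auto)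
  qed (simp_all add: fmult_add lfun_zero lfun_fmult)
qed


section \<open>The coproduct of the root vectors\<close>

text \<open>
  The element \<open>K\<^sub>i K\<^sub>i\<^sub>+\<^sub>1 \<cdots>
  K\<^sub>j\<^sub>-\<^sub>1\<close>, the group-like element belonging to
  \<open>E\<^sub>j\<^sub>i\<close>.
\<close>
fun Kprod :: "nat \<Rightarrow> nat \<Rightarrow> falg" where
  "Kprod i 0 = 1"
| "Kprod i (Suc j) = (if j < i then 1 else Kprod i j * gK j)"

lemma Kprod_empty [simp]: "Kprod i i = 1"
  by (cases i) auto

lemma ucong_commute_mult:
  assumes "ucong n q (z * x) (scal c * (x * z))" "ucong n q (z * y) (scal d * (y * z))"
  shows "ucong n q (z * (x * y)) (scal (c * d) * (x * y * z))"
proof -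
  have "ucong n q (z * x * y) (scal c * (x * z) * y)"
    by (intro ucong_rmult assms)
  also have "scal c * (x * z) * y = scal c * (x * (z * y))"
    by (simp add: mult.assoc)
  also have "ucong n q \<dots> (scal c * (x * (scal d * (y * z))))"
    by (intro ucong_lmult assms)
  also have "\<dots> = scal (c * d) * (x * y * z)"
    by (subst scal_left_commute) (simp add: scal_mult mult.assoc)
  finally show ?thesis by (simp add: mult.assoc)
qed

lemma ucong_commute_mult':
  assumes "ucong n q (x * z) (scal c * (z * x))" "ucong n q (y * z) (scal d * (z * y))"
  shows "ucong n q (x * y * z) (scal (c * d) * (z * (x * y)))"
proof -
  have "ucong n q (x * (y * z)) (x * (scal d * (z * y)))"
    by (intro ucong_lmult assms)
  also have "x * (scal d * (z * y)) = scal d * ((x * z) * y)"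
    by (subst scal_left_commute) (simp add: mult.assoc)
  also have "ucong n q \<dots> (scal d * ((scal c * (z * x)) * y))"
    by (intro ucong_lmult ucong_rmult assms)
  also have "\<dots> = scal (c * d) * (z * (x * y))"
    by (simp add: scal_mult mult.assoc mult.commute[of c])
  finally show ?thesis by (simp add: mult.assoc)
qed

lemma ucong_commute_diff:
  assumes "ucong n q (z * x) (scal c * (x * z))" "ucong n q (z * y) (scal c * (y * z))"
  shows "ucong n q (z * (x - scal d * y)) (scal c * ((x - scal d * y) * z))"
proof -
  have "ucong n q (z * x - scal d * (z * y)) (scal c * (x * z) - scal d * (scal c * (y * z)))"
    by (intro ucong_diff ucong_lmult assms)
  then show ?thesis
    by (simp only: right_diff_distrib left_diff_distrib scal_left_commute[of z] mult.assoc
        scal_left_commute[of "scal d" c])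
qed

lemma Eroot_Suc: "i < j \<Longrightarrow> Eroot q (Suc j) i = gE j * Eroot q j i - scal (inverse (of_real q)) * (Eroot q j i * gE j)"
  by (simp add: of_real_inverse mult.assoc)

lemma Eroot_simple: "Eroot q (Suc i) i = gE i"
  by simp

declare Eroot.simps(2) [simp del]

text \<open>
  An element commuting with the simple root vectors up to scalars commutes with
  \<open>E\<^sub>j\<^sub>i\<close> up to the product of these scalars, as each simple root vector
  between \<open>i\<close> and \<open>j\<close> occurs once in it.
\<close>
lemma ucong_scal_Eroot:
  assumes "i < j" "\<And>k. i \<le> k \<Longrightarrow> k < j \<Longrightarrow> ucong n q (z * gE k) (scal (c k) * (gE k * z))"
  shows "ucong n q (z * Eroot q j i) (scal (\<Prod>k=i..<j. c k) * (Eroot q j i * z))"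
  using assms
proof (induction j)
  case (Suc j)
  show ?case
  proof (cases "i = j")
    case True
    then show ?thesis using Suc.prems(2)[of i] by (simp add: Eroot_simple)
  next
    case False
    then have IH: "ucong n q (z * Eroot q j i) (scal (\<Prod>k=i..<j. c k) * (Eroot q j i * z))"
      using Suc by simp
    have E: "ucong n q (z * gE j) (scal (c j) * (gE j * z))"
      using Suc.prems by simp
    show ?thesis
      using False Suc.prems(1) ucong_commute_diff[OF ucong_commute_mult[OF E IH]
        ucong_commute_mult[OF IH E, unfolded mult.commute[of _ "c j"]], of "inverse (of_real q)"]
      by (simp add: Eroot_Suc mult.commute[of _ "c j"])
  qed
qed simp

lemma ucong_E_Eroot_commute:
  assumes "1 \<le> i" "i < k" "k < j" "j \<le> n"
  shows "ucong n q (gE j * Eroot q k i) (Eroot q k i * gE j)"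
proof -
  have "ucong n q (gE j * gE l) (scal 1 * (gE l * gE j))" if "i \<le> l" "l < k" for l
    using uq_ideal_rel[OF uq_rels.EE[of j n l q]] assms that by (simp add: ucong_def adjacent_def)
  from ucong_scal_Eroot[OF assms(2) this] show ?thesis by simp
qed

lemma ucong_K_Eroot:
  assumes "1 \<le> i" "i < j" "j \<le> n"
  shows "ucong n q (gK j * Eroot q j i) (scal (inverse (of_real q)) * (Eroot q j i * gK j))"
proof -
  define c where "c l = (if Suc l = j then inverse (of_real q) else 1 :: complex)" for l
  have "ucong n q (gK j * gE l) (scal (c l) * (gE l * gK j))" if "i \<le> l" "l < j" for l
    using ucong_KE[of j n l q] assms that
    by (auto simp: cartan_def adjacent_def c_def qpow_def power_int_minus of_real_inverse)
  from ucong_scal_Eroot[OF assms(2) this]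
  have "ucong n q (gK j * Eroot q j i) (scal (prod c {i..<j}) * (Eroot q j i * gK j))" .
  moreover have "prod c {i..<j} = inverse (of_real q)"
  proof -
    have "prod c {i..<j} = prod c {j - 1}"
      using assms by (intro prod.mono_neutral_right) (auto simp: c_def)
    then show ?thesis using assms by (simp add: c_def)
  qed
  ultimately show ?thesis by simp
qed

lemma ucong_Kprod_commute:
  assumes "\<And>l. i \<le> l \<Longrightarrow> l < k \<Longrightarrow> ucong n q (gK l * z) (z * gK l)"
  shows "ucong n q (Kprod i k * z) (z * Kprod i k)"
  using assms
proof (induction k)
  case (Suc k)
  show ?case
  proof (cases "k < i")
    case False
    then show ?thesis
      using Suc ucong_commute_mult'[of n q "Kprod i k" z 1 "gK k" 1] by (simp add: mult.assoc)
  qed simp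
qed simp

lemma ucong_Kprod_E:
  assumes "1 \<le> i" "i < j" "j \<le> n"
  shows "ucong n q (Kprod i j * gE j) (scal (inverse (of_real q)) * (gE j * Kprod i j))"
proof -
  obtain k where k: "j = Suc k" "i \<le> k" using assms by (cases j) auto
  have "ucong n q (Kprod i k * gE j) (scal 1 * (gE j * Kprod i k))"
  proof -
    have "ucong n q (gK l * gE j) (gE j * gK l)" if "i \<le> l" "l < k" for l
      using ucong_KE[of l n j q] assms k that by (simp add: cartan_def adjacent_def)
    from ucong_Kprod_commute[OF this] show ?thesis by simp
  qed
  moreover have "ucong n q (gK k * gE j) (scal (inverse (of_real q)) * (gE j * gK k))"
    using ucong_KE[of k n j q] assms k
    by (auto simp: cartan_def adjacent_def qpow_def power_int_minus of_real_inverse)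
  ultimately show ?thesis
    using ucong_commute_mult' k by fastforce
qed

text \<open>
  The coproduct of the root vectors, \<open>\<Delta>(E\<^sub>j\<^sub>i) = 1 \<otimes>
  E\<^sub>j\<^sub>i + E\<^sub>j\<^sub>i \<otimes> K\<^sub>j\<^sub>i + (1 - q\<^sup>-\<^sup>2)
  \<Sum>\<^sub>i\<^sub><\<^sub>k\<^sub><\<^sub>j E\<^sub>k\<^sub>i \<otimes>
  E\<^sub>j\<^sub>kK\<^sub>k\<^sub>i\<close>, paired with two functionals.  In the step from
  \<open>j\<close> to \<open>j + 1\<close> one takes the
  \<open>q\<^sup>-\<^sup>1\<close>-commutator with \<open>E\<^sub>j \<otimes> K\<^sub>j + 1
  \<otimes> E\<^sub>j\<close>.  The left factors \<open>E\<^sub>k\<^sub>i\<close> with \<open>k <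
  j\<close> commute with \<open>E\<^sub>j\<close>, so that commuting with \<open>E\<^sub>j
  \<otimes> K\<^sub>j\<close> only contributes \<open>E\<^sub>j\<^sub>+\<^sub>1\<^sub>,\<^sub>i
  \<otimes> K\<^sub>j\<^sub>i K\<^sub>j\<close>, while \<open>1 \<otimes> E\<^sub>j\<close>
  produces the right factors \<open>E\<^sub>j\<^sub>+\<^sub>1\<^sub>,\<^sub>k\<close> and, from
  \<open>E\<^sub>j\<^sub>i \<otimes> K\<^sub>j\<^sub>i\<close>, the new summand \<open>k =
  j\<close>.
\<close>
lemma fmult_Eroot:
  assumes "1 \<le> i" "i < j" "j \<le> n + 1" and a: "ufun n q a" and c: "ufun n q c"
  shows "fmult a c (Eroot q j i) = a 1 * c (Eroot q j i) + a (Eroot q j i) * c (Kprod i j)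
    + (1 - inverse (of_real q) ^ 2) * (\<Sum>k\<in>{i<..<j}. a (Eroot q k i) * c (Eroot q j k * Kprod i k))"
  using assms(2-)
proof (induction j arbitrary: a c)
  case (Suc j)
  let ?p = "inverse (of_real q) :: complex"
  show ?case
  proof (cases "i = j")
    case True
    moreover have "{j<..<Suc j} = {}" by auto
    ultimately show ?thesis by (simp add: Eroot_simple fmult_gen)
  next
    case False
    with Suc.prems have ij: "i < j" "j \<le> n" by auto
    let ?X = "Eroot q j i" and ?K = "Kprod i j" and ?S = "{i<..<j}"
    note a = Suc.prems(3) and c = Suc.prems(4)
    have IH: "fmult f g ?X = f 1 * g ?X + f ?X * g ?K
      + (1 - ?p ^ 2) * (\<Sum>k\<in>?S. f (Eroot q k i) * g (Eroot q j k * Kprod i k))"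
      if "ufun n q f" "ufun n q g" for f g
      using Suc.IH[OF ij(1) _ that] ij by simp
    have lf: "lfun a" "lfun c" using a c by (auto simp: ufun_lfun)
    have E: "Eroot q (Suc j) i = gE j * ?X - scal ?p * (?X * gE j)"
      using ij by (simp add: Eroot_Suc)
    have KX: "c (gK j * ?X) = ?p * c (?X * gK j)"
      using ufun_cong[OF c ucong_K_Eroot[of i j]] assms(1) ij lf by (simp add: lfun_scal)
    have KK: "c (gK j * ?K) = c (?K * gK j)"
      using ufun_cong[OF c ucong_sym[OF ucong_Kprod_commute[of i j n q "gK j"]]]
        ucong_KK[of _ n j q] assms(1) ij
      by simp
    have aE: "a (gE j * Eroot q k i) = a (Eroot q k i * gE j)" if "k \<in> ?S" for k
      using ufun_cong[OF a ucong_E_Eroot_commute[of i k j]] that assms(1) ij by simp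
    have cK: "c (gK j * (Eroot q j k * Kprod i k)) = ?p * c (Eroot q j k * (Kprod i k * gK j))"
      if k: "k \<in> ?S" for k
    proof -
      have "ucong n q (Kprod i k * gK j) (gK j * Kprod i k)"
        using ucong_Kprod_commute[of i k n q "gK j"] ucong_KK[of _ n j q] assms(1) ij k by simp
      from ufun_cong[OF c ucong_lmult[OF this]] ufun_rewrite(2)[OF ucong_K_Eroot c, of k j]
        assms(1) ij k
      show ?thesis by simp
    qed
    have cE: "c (?K * gE j) = ?p * c (gE j * ?K)"
      using ufun_cong[OF c ucong_Kprod_E[of i j]] assms(1) ij lf by (simp add: lfun_scal)
    have cE': "c (Eroot q (Suc j) k * Kprod i k)
        = c (gE j * (Eroot q j k * Kprod i k)) - ?p * c (Eroot q j k * (Kprod i k * gE j))"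
      if k: "k \<in> ?S" for k
    proof -
      have "ucong n q (Kprod i k * gE j) (gE j * Kprod i k)"
      proof (rule ucong_Kprod_commute)
        show "ucong n q (gK l * gE j) (gE j * gK l)" if "i \<le> l" "l < k" for l
          using ucong_KE[of l n j q] assms(1) ij k that by (simp add: cartan_def adjacent_def)
      qed
      from ufun_cong[OF c ucong_lmult[OF this]] k ij lf
      show ?thesis by (simp add: Eroot_Suc left_diff_distrib lfun_diff lfun_scal mult.assoc)
    qed
    have S: "{i<..<Suc j} = insert j ?S" using ij by auto
    let ?s1 = "\<Sum>k\<in>?S. a (gE j * Eroot q k i) * c (gK j * (Eroot q j k * Kprod i k))"
    let ?s2 = "\<Sum>k\<in>?S. a (Eroot q k i) * c (gE j * (Eroot q j k * Kprod i k))"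
    let ?s3 = "\<Sum>k\<in>?S. a (Eroot q k i * gE j) * c (Eroot q j k * (Kprod i k * gK j))"
    let ?s4 = "\<Sum>k\<in>?S. a (Eroot q k i) * c (Eroot q j k * (Kprod i k * gE j))"
    let ?s5 = "\<Sum>k\<in>?S. a (Eroot q k i) * c (Eroot q (Suc j) k * Kprod i k)"
    \<comment> \<open>by this equation the sums coming from \<open>E\<^sub>j \<otimes> K\<^sub>j\<close> cancel in the commutator\<close>
    have s13: "?s1 = ?p * ?s3"
      by (simp add: aE cK sum_distrib_left mult.left_commute)
    have s24: "?s5 = ?s2 - ?p * ?s4"
      by (simp add: cE' sum_distrib_left right_diff_distrib sum_subtractf mult.left_commute)
    have "fmult a c (Eroot q (Suc j) i) =
        (a (gE j) * c (gK j * ?X) + a (gE j * ?X) * c (gK j * ?K) + (1 - ?p ^ 2) * ?s1)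
      + (a 1 * c (gE j * ?X) + a ?X * c (gE j * ?K) + (1 - ?p ^ 2) * ?s2)
      - ?p * ((a (gE j) * c (?X * gK j) + a (?X * gE j) * c (?K * gK j) + (1 - ?p ^ 2) * ?s3)
        + (a 1 * c (?X * gE j) + a ?X * c (?K * gE j) + (1 - ?p ^ 2) * ?s4))"
      unfolding E fmult_diff fmult_scal fmult_lgen fmult_rgen
        IH[OF ufun_coprod ufun_coprod, OF a c] IH[OF a ufun_coprod, OF c]
        IH[OF ufun_rcoprod ufun_rcoprod, OF a c] IH[OF a ufun_rcoprod, OF c]
      by (simp add: coprod_def rcoprod_def mult.assoc)
    also have "\<dots> = a 1 * c (Eroot q (Suc j) i) + a (Eroot q (Suc j) i) * c (?K * gK j)
      + (1 - ?p ^ 2) * (a ?X * c (gE j * ?K)) + (1 - ?p ^ 2) * ?s5"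
      unfolding s13 s24 KX KK cE E lfun_diff[OF lf(1)] lfun_diff[OF lf(2)]
        lfun_scal[OF lf(1)] lfun_scal[OF lf(2)]
      by (simp add: algebra_simps power2_eq_square)
    also have "\<dots> = a 1 * c (Eroot q (Suc j) i) + a (Eroot q (Suc j) i) * c (Kprod i (Suc j))
      + (1 - ?p ^ 2) * (\<Sum>k\<in>{i<..<Suc j}. a (Eroot q k i) * c (Eroot q (Suc j) k * Kprod i k))"
      unfolding S using ij by (simp add: Eroot_simple distrib_left)
    finally show ?thesis .
  qed
qed simp


section \<open>The quantized coordinate algebra is a bialgebra\<close>

text \<open>
  A type 1 representation in a basis of weight vectors, given by its matrix coefficients.  An
  arbitrary finite index set instead of an initial segment of the natural numbers makes direct
  sums and tensor products of representations immediate.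
\<close>
definition matrix_coeffs ::
    "nat \<Rightarrow> real \<Rightarrow> 'i set \<Rightarrow> (nat \<Rightarrow> 'i \<Rightarrow> int) \<Rightarrow> ('i \<Rightarrow> 'i \<Rightarrow> func) \<Rightarrow> bool" where
  "matrix_coeffs n q S \<mu> u \<longleftrightarrow> finite S \<and>
     (\<forall>p\<in>S. \<forall>r\<in>S. ufun n q (u p r) \<and> u p r 1 = of_bool (p = r) \<and>
       (\<forall>x y. u p r (x * y) = (\<Sum>k\<in>S. u p k x * u k r y)) \<and>
       (\<forall>i\<in>{1..n}. u p r (gK i) = of_bool (p = r) * qpow q (\<mu> i r)))"

definition coeff_comb :: "'i set \<Rightarrow> ('i \<Rightarrow> complex) \<Rightarrow> ('i \<Rightarrow> 'i \<Rightarrow> func) \<Rightarrow> ('i \<Rightarrow> complex) \<Rightarrow> func" where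
  "coeff_comb S \<xi> u v = (\<lambda>x. \<Sum>p\<in>S. \<Sum>r\<in>S. \<xi> p * u p r x * v r)"

lemma coeff_comb_in_OA:
  assumes "matrix_coeffs n q S \<mu> u"
  shows "coeff_comb S \<xi> u v \<in> OA n q"
proof -
  let ?d = "card S"
  have u: "finite S" "\<And>p r. p \<in> S \<Longrightarrow> r \<in> S \<Longrightarrow> ufun n q (u p r)"
    "\<And>p r. p \<in> S \<Longrightarrow> r \<in> S \<Longrightarrow> u p r 1 = of_bool (p = r)"
    "\<And>p r x y. p \<in> S \<Longrightarrow> r \<in> S \<Longrightarrow> u p r (x * y) = (\<Sum>k\<in>S. u p k x * u k r y)"
    "\<And>p r i. p \<in> S \<Longrightarrow> r \<in> S \<Longrightarrow> i \<in> {1..n} \<Longrightarrow> u p r (gK i) = of_bool (p = r) * qpow q (\<mu> i r)"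
    using assms by (auto simp: matrix_coeffs_def)
  obtain h where h: "bij_betw h {0..<?d} S"
    using ex_bij_betw_nat_finite[OF u(1)] by blast
  have hS: "h k \<in> S" if "k < ?d" for k
    using h that by (auto simp: bij_betw_def)
  have heq: "h p = h r \<longleftrightarrow> p = r" if "p < ?d" "r < ?d" for p r
    using h that by (auto simp: bij_betw_def inj_on_def)
  have reindex: "sum f S = (\<Sum>k=0..<?d. f (h k))" for f :: "'a \<Rightarrow> complex"
    by (rule sum.reindex_bij_betw[OF h, symmetric])
  define \<rho> where "\<rho> x = mat ?d ?d (\<lambda>(p, r). u (h p) (h r) x)" for x
  have lf: "lfun (u (h p) (h r))" if "p < ?d" "r < ?d" for p r
    using u(2) hS that ufun_lfun by blast
  have "type1_rep n q ?d \<rho>"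
    unfolding type1_rep_def
  proof (intro conjI allI ballI)
    show "\<rho> x \<in> carrier_mat ?d ?d" for x by (simp add: \<rho>_def)
    show "\<rho> 1 = 1\<^sub>m ?d"
      by (rule eq_matI) (auto simp: \<rho>_def u(3) hS heq)
    show "\<rho> (x * y) = \<rho> x * \<rho> y" for x y
      by (rule eq_matI) (auto simp: \<rho>_def u(4) hS scalar_prod_def reindex)
    show "\<rho> (x + y) = \<rho> x + \<rho> y" for x y
      by (rule eq_matI) (auto simp: \<rho>_def lfun_add lf)
    show "\<rho> (scal c * x) = c \<cdot>\<^sub>m \<rho> x" for c x
      by (rule eq_matI) (auto simp: \<rho>_def lfun_scal lf)
    show "\<rho> x = 0\<^sub>m ?d ?d" if "x \<in> uq_ideal n q" for x
      using u(2) hS that by (intro eq_matI) (auto simp: \<rho>_def ufun_def)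
    have "\<rho> (gK i) = mat_diag ?d (\<lambda>r. of_real (q powi (\<mu> i (h r))))" if "i \<in> {1..n}" for i
      using that by (intro eq_matI) (auto simp: \<rho>_def mat_diag_def u(5) hS heq qpow_def)
    then show "\<exists>P Q \<mu>. \<forall>i\<in>{1..n}.
        similar_mat_wit (\<rho> (gK i)) (mat_diag ?d (\<lambda>r. of_real (q powi (\<mu> i r :: int)))) P Q"
      by (intro exI[of _ "1\<^sub>m ?d"] exI[of _ "\<lambda>i r. \<mu> i (h r)"])
        (auto intro!: similar_mat_witI[of _ _ ?d]
          simp: left_mult_one_mat[OF mat_diag_dim] right_mult_one_mat[OF mat_diag_dim])
  qed
  moreover have "coeff_comb S \<xi> u v
      = (\<lambda>x. vec ?d (\<lambda>p. \<xi> (h p)) \<bullet> (\<rho> x *\<^sub>v vec ?d (\<lambda>r. v (h r))))"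
    by (rule ext) (simp add: coeff_comb_def scalar_prod_def \<rho>_def reindex sum_distrib_left mult.assoc)
  ultimately show ?thesis
    unfolding OA_def
    by (intro CollectI exI[of _ ?d] exI[of _ \<rho>] exI[of _ "vec ?d (\<lambda>p. \<xi> (h p))"]
        exI[of _ "vec ?d (\<lambda>r. v (h r))"] conjI) auto
qed

text \<open>
  A change of basis by the matrix \<open>P\<close> that diagonalizes the \<open>K\<^sub>i\<close>
  turns any type 1 representation into one of the form \<open>matrix_coeffs\<close>.  The bound on
  \<open>n\<close> is what guarantees that \<open>P\<close> is invertible: for \<open>n =
  0\<close> nothing is said about it.
\<close>
lemma OA_coeff_combE:
  assumes "a \<in> OA n q" "n \<ge> 1"
  obtains d :: nat and \<mu> u \<xi> v where "matrix_coeffs n q {..<d} \<mu> u" "a = coeff_comb {..<d} \<xi> u v"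
proof -
  obtain d \<rho> \<zeta> w where rep: "type1_rep n q d \<rho>" and vecs: "\<zeta> \<in> carrier_vec d" "w \<in> carrier_vec d"
    and a: "a = (\<lambda>x. \<zeta> \<bullet> (\<rho> x *\<^sub>v w))"
    using assms(1) by (auto simp: OA_def)
  have r: "\<And>x. \<rho> x \<in> carrier_mat d d" "\<rho> 1 = 1\<^sub>m d" "\<And>x y. \<rho> (x * y) = \<rho> x * \<rho> y"
    "\<And>x y. \<rho> (x + y) = \<rho> x + \<rho> y" "\<And>c x. \<rho> (scal c * x) = c \<cdot>\<^sub>m \<rho> x"
    "\<And>x. x \<in> uq_ideal n q \<Longrightarrow> \<rho> x = 0\<^sub>m d d"
    using rep by (auto simp: type1_rep_def)
  obtain P Q \<mu> where sim: "\<And>i. i \<in> {1..n} \<Longrightarrow>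
      similar_mat_wit (\<rho> (gK i)) (mat_diag d (\<lambda>r. of_real (q powi (\<mu> i r :: int)))) P Q"
    using rep unfolding type1_rep_def by blast
  have PQ: "P * Q = 1\<^sub>m d" "Q * P = 1\<^sub>m d" "P \<in> carrier_mat d d" "Q \<in> carrier_mat d d"
    using similar_mat_witD2[OF r(1) sim[of 1]] assms(2) by auto
  note [simp] = r(1) PQ
  note assoc = assoc_mult_mat[of _ d d _ d _ d]
  \<comment> \<open>the representation in the basis of weight vectors given by the columns of \<open>P\<close>\<close>
  define \<sigma> where "\<sigma> x = Q * \<rho> x * P" for x
  have \<sigma>: "\<sigma> x \<in> carrier_mat d d" for x
    by (auto simp: \<sigma>_def intro!: mult_carrier_mat[of _ d d])
  define u where "u p r x = \<sigma> x $$ (p, r)" for p r x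
  have "\<sigma> 1 = 1\<^sub>m d"
    by (simp add: \<sigma>_def r(2) right_mult_one_mat[of Q d d])
  moreover have "\<sigma> (x * y) = \<sigma> x * \<sigma> y" for x y
  proof -
    have "\<sigma> x * \<sigma> y = Q * (\<rho> x * ((P * Q) * (\<rho> y * P)))"
      unfolding \<sigma>_def by (simp add: assoc mult_carrier_mat[of _ d d] del: PQ(1,2))
    then show ?thesis
      by (simp add: \<sigma>_def r(3) assoc mult_carrier_mat[of _ d d] left_mult_one_mat[of _ d d])
  qed
  moreover have "\<sigma> (x + y) = \<sigma> x + \<sigma> y" for x y
    by (simp add: \<sigma>_def r(4) mult_add_distrib_mat[of _ d d _ d] add_mult_distrib_mat[of _ d d _ _ d]
        mult_carrier_mat[of _ d d])
  moreover have "\<sigma> (scal c * x) = c \<cdot>\<^sub>m \<sigma> x" for c x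
    by (simp add: \<sigma>_def r(5) mult_smult_distrib[of _ d d _ d] mult_smult_assoc_mat[of _ d d _ d]
        mult_carrier_mat[of _ d d])
  moreover have "\<sigma> x = 0\<^sub>m d d" if "x \<in> uq_ideal n q" for x
    using that by (simp add: \<sigma>_def r(6) right_mult_zero_mat[of Q d d] left_mult_zero_mat[of P d d])
  moreover have "\<sigma> (gK i) = mat_diag d (\<lambda>r. of_real (q powi (\<mu> i r)))" if "i \<in> {1..n}" for i
  proof -
    let ?D = "mat_diag d (\<lambda>r. of_real (q powi (\<mu> i r))) :: complex mat"
    have D: "?D \<in> carrier_mat d d" by (simp add: mat_diag_def)
    have "\<sigma> (gK i) = (Q * P) * (?D * (Q * P))"
      using similar_mat_witD2(3)[OF r(1) sim[OF that]] D
      unfolding \<sigma>_def by (simp add: assoc mult_carrier_mat[of _ d d] del: PQ(1,2))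
    then show ?thesis by (simp add: left_mult_one_mat[OF mat_diag_dim] right_mult_one_mat[OF mat_diag_dim])
  qed
  ultimately have "matrix_coeffs n q {..<d} \<mu> u"
    using \<sigma> carrier_matD[OF \<sigma>]
    unfolding matrix_coeffs_def ufun_def lfun_def u_def
    by (auto simp: scalar_prod_def mat_diag_def qpow_def atLeast0LessThan)
  moreover have "a = coeff_comb {..<d} (\<lambda>p. (transpose_mat P *\<^sub>v \<zeta>) $ p) u (\<lambda>r. (Q *\<^sub>v w) $ r)"
  proof
    fix x
    have "P * \<sigma> x * Q = (P * Q) * (\<rho> x * (P * Q))"
      unfolding \<sigma>_def by (simp add: assoc mult_carrier_mat[of _ d d] del: PQ(1,2))
    then have "\<rho> x = P * \<sigma> x * Q"
      by (simp add: left_mult_one_mat[of _ d d] right_mult_one_mat[of _ d d])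
    then have "\<rho> x *\<^sub>v w = P *\<^sub>v (\<sigma> x *\<^sub>v (Q *\<^sub>v w))"
      using vecs \<sigma> by (simp add: assoc_mult_mat_vec[of _ d d _ d] mult_carrier_mat[of _ d d]
          mult_mat_vec_carrier[of _ d d])
    then have "a x = (transpose_mat P *\<^sub>v \<zeta>) \<bullet> (\<sigma> x *\<^sub>v (Q *\<^sub>v w))"
      unfolding a using vecs \<sigma>[of x]
      by (subst transpose_vec_mult_scalar[of _ d d]) (auto intro!: mult_mat_vec_carrier[of _ d d])
    moreover define y where "y = Q *\<^sub>v w"
    moreover have "(\<sigma> x *\<^sub>v y) $ p = (\<Sum>r<d. u p r x * y $ r)" if "p < d" for p
      using \<sigma>[of x] that carrier_matD[OF PQ(4)]
      by (simp add: u_def scalar_prod_def y_def atLeast0LessThan)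
    moreover have "dim_vec (\<sigma> x *\<^sub>v y) = d"
      using \<sigma>[of x] by simp
    ultimately show "a x = coeff_comb {..<d} (\<lambda>p. (transpose_mat P *\<^sub>v \<zeta>) $ p) u (\<lambda>r. (Q *\<^sub>v w) $ r) x"
      by (simp add: coeff_comb_def scalar_prod_def sum_distrib_left mult.assoc atLeast0LessThan
          del: index_mult_mat_vec)
  qed
  ultimately show ?thesis using that by blast
qed

lemma coeff_comb_Sum:
  assumes "finite S" "finite T"
  shows "coeff_comb (S <+> T) (case_sum \<xi> \<eta>) (\<lambda>p r. case (p, r) of (Inl p, Inl r) \<Rightarrow> u p r
      | (Inr p, Inr r) \<Rightarrow> w p r | _ \<Rightarrow> (\<lambda>x. 0)) (case_sum v v')
    = fadd (coeff_comb S \<xi> u v) (coeff_comb T \<eta> w v')"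
  using assms by (auto simp: coeff_comb_def fadd_def sum.Plus)

text \<open>The direct sum of two representations.\<close>
lemma OA_fadd:
  assumes "n \<ge> 1" "a \<in> OA n q" "b \<in> OA n q"
  shows "fadd a b \<in> OA n q"
proof -
  obtain d \<mu> u \<xi> v where a: "matrix_coeffs n q {..<d::nat} \<mu> u" "a = coeff_comb {..<d} \<xi> u v"
    using OA_coeff_combE assms by metis
  obtain e \<nu> w \<eta> v' where b: "matrix_coeffs n q {..<e::nat} \<nu> w" "b = coeff_comb {..<e} \<eta> w v'"
    using OA_coeff_combE assms by metis
  have "ufun n q (\<lambda>x. 0)" by (simp add: ufun_def lfun_def)
  then have "matrix_coeffs n q ({..<d} <+> {..<e}) (\<lambda>i. case_sum (\<mu> i) (\<nu> i))
    (\<lambda>p r. case (p, r) of (Inl p, Inl r) \<Rightarrow> u p r | (Inr p, Inr r) \<Rightarrow> w p r | _ \<Rightarrow> (\<lambda>x. 0))"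
    using a(1) b(1) by (auto simp: matrix_coeffs_def sum.Plus)
  from coeff_comb_in_OA[OF this] show ?thesis
    unfolding a(2) b(2) coeff_comb_Sum[OF finite_lessThan finite_lessThan, symmetric] .
qed

lemma fmult_sum_left:
  "finite I \<Longrightarrow> fmult (\<lambda>x. \<Sum>i\<in>I. t i * c i x) b x = (\<Sum>i\<in>I. t i * fmult (c i) b x)"
  and fmult_sum_right:
  "finite I \<Longrightarrow> fmult a (\<lambda>x. \<Sum>i\<in>I. t i * c i x) x = (\<Sum>i\<in>I. t i * fmult a (c i) x)"
  unfolding fmult_def
  by (simp_all add: sum_distrib_left sum_distrib_right algebra_simps sum.swap[of _ I])

text \<open>
  The coproduct is an algebra homomorphism, so that products of matrix coefficients are the matrix
  coefficients of the tensor product.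
\<close>
lemma fmult_mult:
  assumes "\<And>x y. a (x * y) = (\<Sum>k\<in>S. a1 k x * a2 k y)"
    and "\<And>x y. b (x * y) = (\<Sum>l\<in>T. b1 l x * b2 l y)"
    and "finite S" "finite T"
  shows "fmult a b (x * y) = (\<Sum>k\<in>S. \<Sum>l\<in>T. fmult (a1 k) (b1 l) x * fmult (a2 k) (b2 l) y)"
proof (rule lfun_eqI[of "\<lambda>x. fmult a b (x * y)"])
  show "lfun (\<lambda>x. fmult a b (x * y))" by (intro lfun_rmult lfun_fmult)
  show "lfun (\<lambda>x. \<Sum>k\<in>S. \<Sum>l\<in>T. fmult (a1 k) (b1 l) x * fmult (a2 k) (b2 l) y)"
    by (intro lfun_sum lfun_cmult2 lfun_fmult)
next
  fix w
  show "fmult a b (wmono w * y)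
    = (\<Sum>k\<in>S. \<Sum>l\<in>T. fmult (a1 k) (b1 l) (wmono w) * fmult (a2 k) (b2 l) y)"
    using assms(1,2)
  proof (induction w arbitrary: a b a1 b1 rule: falg_word_induct)
    case Nil
    have "a = (\<lambda>y. \<Sum>k\<in>S. a1 k 1 * a2 k y)" "b = (\<lambda>y. \<Sum>l\<in>T. b1 l 1 * b2 l y)"
      using Nil(1)[of 1] Nil(2)[of 1] by auto
    then have "fmult a b y = (\<Sum>k\<in>S. \<Sum>l\<in>T. a1 k 1 * (b1 l 1 * fmult (a2 k) (b2 l) y))"
      using assms(3,4) by (simp add: fmult_sum_left fmult_sum_right sum_distrib_left)
    then show ?case by (simp add: mult.assoc)
  next
    case (Cons g x)
    have a: "coprod a z (x * y) = (\<Sum>k\<in>S. coprod (a1 k) z x * a2 k y)" for z x y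
      using Cons(2)[of "z * x" y] by (simp add: coprod_def mult.assoc)
    have b: "coprod b z (x * y) = (\<Sum>l\<in>T. coprod (b1 l) z x * b2 l y)" for z x y
      using Cons(3)[of "z * x" y] by (simp add: coprod_def mult.assoc)
    show ?case
      by (cases g) (simp_all add: wmono_gen mult.assoc fmult_lgen Cons.IH[OF a b]
          Cons.IH[OF Cons.prems(1) b] Cons.IH[OF a Cons.prems(2)] distrib_right sum.distrib)
  qed
qed

lemma sum_Times: "(\<Sum>p\<in>A \<times> B. f p) = (\<Sum>x\<in>A. \<Sum>y\<in>B. f (x, y))"
  by (simp add: sum.cartesian_product)

lemma OA_fmult:
  assumes "n \<ge> 1" "q \<noteq> 0" "a \<in> OA n q" "b \<in> OA n q"
  shows "fmult a b \<in> OA n q"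
proof -
  obtain d \<mu> u \<xi> v where a: "matrix_coeffs n q {..<d::nat} \<mu> u" "a = coeff_comb {..<d} \<xi> u v"
    using OA_coeff_combE assms by metis
  obtain e \<nu> w \<eta> v' where b: "matrix_coeffs n q {..<e::nat} \<nu> w" "b = coeff_comb {..<e} \<eta> w v'"
    using OA_coeff_combE assms by metis
  let ?S = "{..<d} \<times> {..<e}"
  let ?U = "\<lambda>p r. fmult (u (fst p) (fst r)) (w (snd p) (snd r))"
  have mc: "matrix_coeffs n q ?S (\<lambda>i r. \<mu> i (fst r) + \<nu> i (snd r)) ?U"
    unfolding matrix_coeffs_def
  proof (intro conjI ballI allI)
    fix p r assume pr: "p \<in> ?S" "r \<in> ?S"
    show "ufun n q (?U p r)"
      using pr a(1) b(1) assms(2) by (intro ufun_fmult) (auto simp: matrix_coeffs_def)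
    show "?U p r 1 = of_bool (p = r)"
      using pr a(1) b(1) by (auto simp: matrix_coeffs_def)
    show "?U p r (x * y) = (\<Sum>k\<in>?S. ?U p k x * ?U k r y)" for x y
      using pr a(1) b(1)
      by (subst fmult_mult[where S = "{..<d}" and T = "{..<e}" and ?a1.0 = "u (fst p)" and ?b1.0 = "w (snd p)"
            and ?a2.0 = "\<lambda>k. u k (fst r)" and ?b2.0 = "\<lambda>k. w k (snd r)"])
        (auto simp: matrix_coeffs_def sum_Times)
    show "?U p r (gK i) = of_bool (p = r) * qpow q (\<mu> i (fst r) + \<nu> i (snd r))" if "i \<in> {1..n}" for i
      using pr a(1) b(1) that assms(2) by (auto simp: matrix_coeffs_def fmult_gen qpow_add)
  qed auto
  have "fmult a b = coeff_comb ?S (\<lambda>p. \<xi> (fst p) * \<eta> (snd p)) ?U (\<lambda>p. v (fst p) * v' (snd p))"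
  proof
    fix x
    have a': "a = (\<lambda>x. \<Sum>p\<in>{..<d} \<times> {..<d}. (\<xi> (fst p) * v (snd p)) * u (fst p) (snd p) x)"
      by (simp add: a(2) coeff_comb_def sum_Times mult_ac)
    have b': "b = (\<lambda>x. \<Sum>p\<in>{..<e} \<times> {..<e}. (\<eta> (fst p) * v' (snd p)) * w (fst p) (snd p) x)"
      by (simp add: b(2) coeff_comb_def sum_Times mult_ac)
    have "fmult a b x = (\<Sum>p<d. \<Sum>r<d. \<Sum>s<e. \<Sum>t<e. \<xi> p * v r * (\<eta> s * v' t * fmult (u p r) (w s t) x))"
      unfolding a' b'
      by (simp add: fmult_sum_left fmult_sum_right sum_distrib_left) (simp add: sum_Times)
    also have "\<dots> = (\<Sum>p<d. \<Sum>s<e. \<Sum>r<d. \<Sum>t<e. \<xi> p * v r * (\<eta> s * v' t * fmult (u p r) (w s t) x))"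
      by (intro sum.cong refl sum.swap)
    also have "\<dots> = coeff_comb ?S (\<lambda>p. \<xi> (fst p) * \<eta> (snd p)) ?U (\<lambda>p. v (fst p) * v' (snd p)) x"
      by (simp add: coeff_comb_def sum_Times mult_ac)
    finally show "fmult a b x = coeff_comb ?S (\<lambda>p. \<xi> (fst p) * \<eta> (snd p)) ?U (\<lambda>p. v (fst p) * v' (snd p)) x" .
  qed
  then show ?thesis using coeff_comb_in_OA[OF mc] by simp
qed

lemma OA_ufun:
  assumes "n \<ge> 1" "a \<in> OA n q"
  shows "ufun n q a"
proof -
  obtain d \<mu> u \<xi> v where a: "matrix_coeffs n q {..<d::nat} \<mu> u" "a = coeff_comb {..<d} \<xi> u v"
    using OA_coeff_combE assms by metis
  then have "lfun a"
    unfolding a(2) coeff_comb_def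
    by (intro lfun_sum lfun_cmult lfun_cmult2 ufun_lfun[of n q]) (auto simp: matrix_coeffs_def)
  then show ?thesis
    using a by (auto simp: ufun_def matrix_coeffs_def coeff_comb_def)
qed

lemma OA_fzero: "n \<ge> 1 \<Longrightarrow> fzero \<in> OA n q"
  using coeff_comb_in_OA[of n q "{}::nat set" undefined undefined undefined undefined]
  by (simp add: matrix_coeffs_def coeff_comb_def fzero_def)


lemma OA_fsmult:
  assumes "n \<ge> 1" "a \<in> OA n q"
  shows "fsmult t a \<in> OA n q"
proof -
  obtain d \<mu> u \<xi> v where a: "matrix_coeffs n q {..<d::nat} \<mu> u" "a = coeff_comb {..<d} \<xi> u v"
    using OA_coeff_combE assms by metis
  have "fsmult t a = coeff_comb {..<d} (\<lambda>p. t * \<xi> p) u v"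
    by (simp add: a(2) coeff_comb_def fsmult_def sum_distrib_left mult.assoc)
  then show ?thesis using coeff_comb_in_OA[OF a(1)] by simp
qed

lemma matrix_coeff_in_OA:
  assumes "matrix_coeffs n q S \<mu> u" "p \<in> S" "r \<in> S"
  shows "u p r \<in> OA n q"
proof -
  have fin: "finite S" using assms(1) by (simp add: matrix_coeffs_def)
  let ?e = "\<lambda>s k. if k = s then 1 else 0 :: complex"
  have "coeff_comb S (?e p) u (?e r) x = u p r x" for x
  proof -
    have "coeff_comb S (?e p) u (?e r) x
      = (\<Sum>k\<in>S. if k = p then \<Sum>l\<in>S. if l = r then u k l x else 0 else 0)"
      unfolding coeff_comb_def by (intro sum.cong refl) (auto intro!: sum.cong)
    with fin assms(2,3) show ?thesis by simp
  qed
  then have "coeff_comb S (?e p) u (?e r) = u p r" by blast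
  then show ?thesis
    by (rule subst) (rule coeff_comb_in_OA[OF assms(1)])
qed

lemma counit_linext: "counit = linext (\<lambda>w. prod_list (map counit_gen (letters w)))"
  by (rule ext) (simp add: counit_def linext_def)

lemma lfun_counit: "lfun counit"
  by (simp add: counit_linext lfun_linext)

lemma counit_mult: "counit (x * y) = counit x * counit y"
proof (rule lfun_eqI[of "\<lambda>x. counit (x * y)"])
  fix v
  show "counit (wmono v * y) = counit (wmono v) * counit y"
  proof (rule lfun_eqI[of "\<lambda>y. counit (wmono v * y)"])
    show "counit (wmono v * wmono w) = counit (wmono v) * counit (wmono w)" for w
      by (simp flip: wmono_add) (simp add: counit_linext wmono_def plus_word_def)
  qed (intro lfun_lmult lfun_cmult lfun_counit)+
qed (intro lfun_rmult lfun_cmult2 lfun_counit)+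

lemma counit_values [simp]:
  "counit (gE i) = 0" "counit (gF i) = 0" "counit (gK i) = 1" "counit (gKi i) = 1" "counit 1 = 1"
  by (simp_all add: counit_linext gen_defs wmono_def zero_word_def flip: single_one)

lemma counit_in_OA: "counit \<in> OA n q"
proof -
  have "counit r = 0" if "r \<in> uq_rels n q" for r
    using that by cases (simp_all add: lfun_counit lfun_diff lfun_add lfun_zero counit_mult)
  then have "ufun n q counit"
    unfolding ufun_def using lfun_counit
    by (auto elim: uq_ideal.induct simp: lfun_add lfun_zero counit_mult)
  then have "matrix_coeffs n q {()} (\<lambda>i r. 0) (\<lambda>p r. counit)"
    by (simp add: matrix_coeffs_def counit_mult)
  from matrix_coeff_in_OA[OF this] show ?thesis by simp
qed


section \<open>A symmetric power of the vector representation\<close>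

text \<open>The quantum integer \<open>[k]\<close>.\<close>
definition qnum :: "real \<Rightarrow> int \<Rightarrow> complex" where
  "qnum q k = (qpow q k - qpow q (- k)) / (of_real q - inverse (of_real q))"

lemma qnum_0 [simp]: "qnum q 0 = 0"
  by (simp add: qnum_def)

lemma q_minus_inverse_nonzero:
  assumes "q \<noteq> 0" "q \<noteq> 1" "q \<noteq> -1"
  shows "complex_of_real q - inverse (of_real q) \<noteq> 0"
proof
  assume "complex_of_real q - inverse (of_real q) = 0"
  then have "q * q = 1"
    using assms by (simp add: field_simps flip: of_real_mult)
  with assms show False by (simp add: square_eq_1_iff)
qed

lemma qnum_1: "q \<noteq> 0 \<Longrightarrow> q \<noteq> 1 \<Longrightarrow> q \<noteq> -1 \<Longrightarrow> qnum q 1 = 1"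
  using q_minus_inverse_nonzero[of q] by (simp add: qnum_def qpow_1 qpow_minus)

lemma qpow_neighbours:
  assumes "q \<noteq> 0"
  shows "qpow q (k + 1) = qpow q k * of_real q" "qpow q (k - 1) = qpow q k / of_real q"
    "qpow q (- (k + 1)) = 1 / (qpow q k * of_real q)" "qpow q (- (k - 1)) = of_real q / qpow q k"
    "qpow q (- k) = 1 / qpow q k" "qpow q (k - l) = qpow q k / qpow q l"
    "qpow q (- (k - l)) = qpow q l / qpow q k"
  using qpow_add[OF assms, of k 1] qpow_add[OF assms, of k "-1"] qpow_add[OF assms, of k "- l"]
  by (simp_all only: qpow_minus diff_conv_add_uminus qpow_1 divide_inverse inverse_mult_distrib
      inverse_inverse_eq mult_1_left mult.commute)

text \<open>This recursion is what makes the Serre relations hold on monomials.\<close>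
lemma qnum_rec:
  assumes "q \<noteq> 0"
  shows "qnum q (k + 1) + qnum q (k - 1) = (of_real q + inverse (of_real q)) * qnum q k"
proof -
  have "qpow q (k + 1) - qpow q (- (k + 1)) + (qpow q (k - 1) - qpow q (- (k - 1)))
      = (of_real q + inverse (of_real q)) * (qpow q k - qpow q (- k))"
    unfolding qpow_neighbours(1-5)[OF assms] using assms qpow_nonzero[OF assms, of k]
    by (simp add: field_simps)
  then show ?thesis
    by (simp only: qnum_def add_divide_distrib[symmetric] times_divide_eq_right)
qed

lemma qnum_reduce:
  assumes "q \<noteq> 0"
  shows "qnum q (1 + k) = (of_real q + inverse (of_real q)) * qnum q k - qnum q (k - 1)"
    "qnum q (2 + k) = (of_real q + inverse (of_real q)) * qnum q (1 + k) - qnum q k"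
  using qnum_rec[OF assms, of k] qnum_rec[OF assms, of "1 + k"] by (simp_all add: algebra_simps)

text \<open>
  This identity is what makes the relation for \<open>E\<^sub>iF\<^sub>i -
  F\<^sub>iE\<^sub>i\<close> hold on monomials.
\<close>
lemma qnum_diff:
  assumes "q \<noteq> 0" "q \<noteq> 1" "q \<noteq> -1"
  shows "qnum q k * qnum q (l + 1) - qnum q l * qnum q (k + 1) = qnum q (k - l)"
proof -
  define c where "c = complex_of_real q - inverse (of_real q)"
  have c: "c \<noteq> 0" using q_minus_inverse_nonzero[OF assms] by (simp add: c_def)
  have "(qpow q k - qpow q (- k)) * (qpow q (l + 1) - qpow q (- (l + 1)))
      - (qpow q l - qpow q (- l)) * (qpow q (k + 1) - qpow q (- (k + 1)))
      = (qpow q (k - l) - qpow q (- (k - l))) * c"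
    unfolding qpow_neighbours[OF assms(1)] c_def
    using assms(1) qpow_nonzero[OF assms(1), of k] qpow_nonzero[OF assms(1), of l]
    by (simp add: field_simps)
  then show ?thesis
    using c unfolding qnum_def c_def[symmetric] by (simp add: divide_simps)
qed

text \<open>
  The generators act on the monomials \<open>x\<^sup>m\<close> in variables \<open>x\<^sub>1,
  \<dots>, x\<^sub>n\<^sub>+\<^sub>1\<close> by \<open>E\<^sub>i x\<^sup>m =
  [m\<^sub>i\<^sub>+\<^sub>1] x\<^sub>i x\<^sub>i\<^sub>+\<^sub>1\<^sup>-\<^sup>1
  x\<^sup>m\<close> and \<open>F\<^sub>i x\<^sup>m = [m\<^sub>i] x\<^sub>i\<^sub>+\<^sub>1
  x\<^sub>i\<^sup>-\<^sup>1 x\<^sup>m\<close>, while \<open>x\<^sup>m\<close> has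
  \<open>K\<^sub>i\<close>-eigenvalue \<open>q\<close> to the power \<open>m\<^sub>i -
  m\<^sub>i\<^sub>+\<^sub>1\<close>.  Admitting negative exponents frees the relations of side
  conditions; the homogeneous polynomials form a subrepresentation since \<open>[0] = 0\<close>.
\<close>
fun shift :: "gen \<Rightarrow> nat \<Rightarrow> int" where
  "shift (GE i) k = of_bool (k = i) - of_bool (k = Suc i)"
| "shift (GF i) k = of_bool (k = Suc i) - of_bool (k = i)"
| "shift (GK i) k = 0"
| "shift (GKi i) k = 0"

definition move :: "gen \<Rightarrow> (nat \<Rightarrow> int) \<Rightarrow> nat \<Rightarrow> int" where
  "move g m = (\<lambda>k. m k + shift g k)"

fun sym_act :: "nat \<Rightarrow> real \<Rightarrow> gen \<Rightarrow> (nat \<Rightarrow> int) \<Rightarrow> complex" where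
  "sym_act n q (GE i) m = (if i \<in> {1..n} then qnum q (m (Suc i)) else 0)"
| "sym_act n q (GF i) m = (if i \<in> {1..n} then qnum q (m i) else 0)"
| "sym_act n q (GK i) m = (if i \<in> {1..n} then qpow q (m i - m (Suc i)) else 1)"
| "sym_act n q (GKi i) m = (if i \<in> {1..n} then qpow q (m (Suc i) - m i) else 1)"

text \<open>
  The coefficient of \<open>x\<^sup>p\<close> in the image of \<open>x\<^sup>r\<close>.  The
  letters are applied from the head of the list, so the list is the reversal of the word acting.
\<close>
fun sym_word :: "nat \<Rightarrow> real \<Rightarrow> (nat \<Rightarrow> int) \<Rightarrow> (nat \<Rightarrow> int) \<Rightarrow> gen list \<Rightarrow> complex" where
  "sym_word n q p r [] = of_bool (p = r)"
| "sym_word n q p r (g # l) = sym_act n q g r * sym_word n q p (move g r) l"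

definition sym_coeff :: "nat \<Rightarrow> real \<Rightarrow> (nat \<Rightarrow> int) \<Rightarrow> (nat \<Rightarrow> int) \<Rightarrow> func" where
  "sym_coeff n q p r = linext (\<lambda>w. sym_word n q p r (rev (letters w)))"

lemma lfun_sym_coeff: "lfun (sym_coeff n q p r)"
  by (simp add: sym_coeff_def lfun_linext)

lemma sym_coeff_one: "sym_coeff n q p r 1 = of_bool (p = r)"
  by (simp add: sym_coeff_def zero_word_def flip: single_one)

lemma sym_coeff_mult_gen:
  "sym_coeff n q p r (x * wmono (Word [g])) = sym_act n q g r * sym_coeff n q p (move g r) x"
proof (rule lfun_eqI[of "\<lambda>x. sym_coeff n q p r (x * wmono (Word [g]))"])
  fix w
  show "sym_coeff n q p r (wmono w * wmono (Word [g]))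
    = sym_act n q g r * sym_coeff n q p (move g r) (wmono w)"
    by (simp flip: wmono_add) (simp add: sym_coeff_def wmono_def plus_word_def)
qed (intro lfun_rmult lfun_cmult lfun_sym_coeff)+

lemma sym_coeff_gen:
  "sym_coeff n q p r (wmono (Word [g])) = sym_act n q g r * of_bool (p = move g r)"
  using sym_coeff_mult_gen[of n q p r 1 g] by (simp add: sym_coeff_one)

lemma sym_coeff_scal: "sym_coeff n q p r (scal c) = c * of_bool (p = r)"
  using lfun_scal[OF lfun_sym_coeff, of n q p r c 1] by (simp add: sym_coeff_one)

lemma move_commute: "move g (move h m) = move h (move g m)"
  by (simp add: move_def algebra_simps)

lemma move_K [simp]: "move (GK i) m = m" "move (GKi i) m = m"
  by (simp_all add: move_def)

lemma move_EF [simp]: "move (GE i) (move (GF i) m) = m" "move (GF i) (move (GE i) m) = m"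
  by (auto simp: move_def fun_eq_iff)

lemma shift_cartan: "shift (GE j) i - shift (GE j) (Suc i) = cartan i j"
  "shift (GF j) i - shift (GF j) (Suc i) = - cartan i j"
  by (auto simp: cartan_def adjacent_def)

lemma move_apply: "move g m k = m k + shift g k"
  by (simp add: move_def)

lemmas sym_coeff_simps = lfun_sym_coeff lfun_diff lfun_add lfun_scal sym_coeff_one gen_defs
  sym_coeff_mult_gen sym_coeff_gen sym_coeff_scal

text \<open>
  All words of a relation send a monomial to multiples of the same monomial, so each relation
  becomes an identity between quantum integers.
\<close>
lemma sym_coeff_rel:
  assumes q: "q \<noteq> 0" "q \<noteq> 1" "q \<noteq> -1" and "x \<in> uq_rels n q"
  shows "sym_coeff n q p r x = 0"
  using assms(4)
proof cases
  case (KE i j)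
  have "qpow q (move (GE j) r i - move (GE j) r (Suc i)) = qpow q (cartan i j) * qpow q (r i - r (Suc i))"
  proof -
    have "move (GE j) r i - move (GE j) r (Suc i) = cartan i j + (r i - r (Suc i))"
      using shift_cartan(1)[of j i] unfolding move_apply by linarith
    then show ?thesis using qpow_add[OF q(1)] by metis
  qed
  with KE(2,3) show ?thesis unfolding KE(1) qpow_def[symmetric] mult.assoc
    by (simp add: sym_coeff_simps)
next
  case (KF i j)
  have "qpow q (move (GF j) r i - move (GF j) r (Suc i)) = qpow q (- cartan i j) * qpow q (r i - r (Suc i))"
  proof -
    have "move (GF j) r i - move (GF j) r (Suc i) = - cartan i j + (r i - r (Suc i))"
      using shift_cartan(2)[of j i] unfolding move_apply by linarith
    then show ?thesis using qpow_add[OF q(1)] by metis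
  qed
  with KF(2,3) show ?thesis unfolding KF(1) qpow_def[symmetric] mult.assoc
    by (simp add: sym_coeff_simps)
next
  case (EF i j)
  show ?thesis
  proof (cases "i = j")
    case True
    have "qnum q (r j) * qnum q (r (Suc j) + 1) - qnum q (r (Suc j)) * qnum q (r j + 1)
      = (qpow q (r j - r (Suc j)) - qpow q (r (Suc j) - r j)) * of_real (1 / (q - inverse q))"
      unfolding qnum_diff[OF q] by (simp add: qnum_def field_simps)
    with EF(2) show ?thesis unfolding EF(1) True
      by (cases "p = r") (simp_all add: sym_coeff_simps move_apply algebra_simps)
  next
    case False
    with EF show ?thesis
      by (auto simp: sym_coeff_simps move_apply move_commute[of "GE i"])
  qed
next
  case (EE i j)
  then show ?thesis
    by (simp add: sym_coeff_simps move_apply move_commute[of "GE i"] adjacent_def)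
next
  case (FF i j)
  then show ?thesis
    by (simp add: sym_coeff_simps move_apply move_commute[of "GF i"] adjacent_def)
next
  case (serreE i j)
  let ?m = "move (GE i) (move (GE i) (move (GE j) r))"
  have 1: "move (GE i) (move (GE j) (move (GE i) r)) = move (GE i) (move (GE i) (move (GE j) r))"
    "move (GE j) (move (GE i) (move (GE i) r)) = move (GE i) (move (GE i) (move (GE j) r))"
    by (metis move_commute)+
  show ?thesis
    unfolding serreE(1)
    using serreE(2-4)
    by (cases "p = ?m") (auto simp: sym_coeff_simps move_apply adjacent_def 1 qnum_reduce[OF q(1)] algebra_simps
        simp del: mult.assoc simp add: mult.assoc[where 'a = complex])
next
  case (serreF i j)
  let ?m = "move (GF i) (move (GF i) (move (GF j) r))"
  have 1: "move (GF i) (move (GF j) (move (GF i) r)) = move (GF i) (move (GF i) (move (GF j) r))"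
    "move (GF j) (move (GF i) (move (GF i) r)) = move (GF i) (move (GF i) (move (GF j) r))"
    by (metis move_commute)+
  show ?thesis
    unfolding serreF(1)
    using serreF(2-4)
    by (cases "p = ?m") (auto simp: sym_coeff_simps move_apply adjacent_def 1 qnum_reduce[OF q(1)] algebra_simps
        simp del: mult.assoc simp add: mult.assoc[where 'a = complex])
qed (auto simp: sym_coeff_simps q simp flip: qpow_add)

text \<open>
  The exponents of the monomials of degree \<open>n + 1\<close> in \<open>n + 1\<close> variables.
\<close>
definition sym_index :: "nat \<Rightarrow> (nat \<Rightarrow> int) set" where
  "sym_index n = {m. (\<forall>k. m k \<ge> 0) \<and> (\<forall>k. k \<notin> {1..n + 1} \<longrightarrow> m k = 0) \<and>
     (\<Sum>k\<in>{1..n + 1}. m k) = int (n + 1)}"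

lemma finite_sym_index: "finite (sym_index n)"
proof (rule finite_subset)
  have "m k \<le> int (n + 1)" if "m \<in> sym_index n" "k \<in> {1..n + 1}" for m k
    using that member_le_sum[of k "{1..n + 1}" m] by (auto simp: sym_index_def)
  then show "sym_index n \<subseteq> {m. \<forall>k. (k \<in> {1..n + 1} \<longrightarrow> m k \<in> {0..int (n + 1)}) \<and> (k \<notin> {1..n + 1} \<longrightarrow> m k = 0)}"
    by (auto simp: sym_index_def)
  show "finite {m. \<forall>k. (k \<in> {1..n + 1} \<longrightarrow> m k \<in> {0..int (n + 1)}) \<and> (k \<notin> {1..n + 1} \<longrightarrow> m k = 0)}"
    by (rule finite_set_of_finite_funs) auto
qed

text \<open>
  Only a move that takes away a variable that is absent would leave the polynomials, and there the
  coefficient \<open>[0]\<close> vanishes.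
\<close>
lemma move_in_sym_index:
  assumes "r \<in> sym_index n" "sym_act n q g r \<noteq> 0"
  shows "move g r \<in> sym_index n"
proof -
  have sum: "(\<Sum>k\<in>{1..n + 1}. of_bool (k = l)) = (1::int)" if "l \<in> {1..n + 1}" for l
    using that by (simp add: of_bool_def)
  have nonneg: "r k \<ge> 0" for k using assms(1) by (simp add: sym_index_def)
  have pos: "r k \<ge> 1" if "qnum q (r k) \<noteq> 0" for k
    using nonneg[of k] that by (cases "r k = 0") auto
  show ?thesis
  proof (cases g)
    case (GE i)
    with assms(2) have i: "i \<in> {1..n}" "r (Suc i) \<ge> 1" by (auto intro: pos split: if_splits)
    then have "(\<Sum>k\<in>{1..n + 1}. shift g k) = 0"
      using sum[of i] sum[of "Suc i"] by (simp add: GE sum_subtractf del: sum_of_bool_eq)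
    with i assms(1) nonneg show ?thesis
      by (auto simp: sym_index_def move_def sum.distrib GE)
  next
    case (GF i)
    with assms(2) have i: "i \<in> {1..n}" "r i \<ge> 1" by (auto intro: pos split: if_splits)
    then have "(\<Sum>k\<in>{1..n + 1}. shift g k) = 0"
      using sum[of i] sum[of "Suc i"] by (simp add: GF sum_subtractf del: sum_of_bool_eq)
    with i assms(1) nonneg show ?thesis
      by (auto simp: sym_index_def move_def sum.distrib GF)
  qed (use assms in simp_all)
qed

lemma sym_coeff_mult:
  assumes "r \<in> sym_index n"
  shows "sym_coeff n q p r (x * y) = (\<Sum>k\<in>sym_index n. sym_coeff n q p k x * sym_coeff n q k r y)"
proof (rule lfun_eqI[of "\<lambda>y. sym_coeff n q p r (x * y)"])
  show "lfun (\<lambda>y. sym_coeff n q p r (x * y))"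
    by (intro lfun_lmult lfun_sym_coeff)
  show "lfun (\<lambda>y. \<Sum>k\<in>sym_index n. sym_coeff n q p k x * sym_coeff n q k r y)"
    by (intro lfun_sum lfun_cmult lfun_sym_coeff)
next
  fix w
  show "sym_coeff n q p r (x * wmono w)
    = (\<Sum>k\<in>sym_index n. sym_coeff n q p k x * sym_coeff n q k r (wmono w))"
    using assms
  proof (induction w arbitrary: r rule: falg_word_rev_induct)
    case Nil
    then show ?case
      by (simp add: sym_coeff_one of_bool_def if_distrib finite_sym_index cong: if_cong)
  next
    case (snoc g y)
    show ?case
    proof (cases "sym_act n q g r = 0")
      case True
      then show ?thesis by (simp add: sym_coeff_mult_gen flip: mult.assoc)
    next
      case False
      then show ?thesis
        using snoc.IH[OF move_in_sym_index[OF snoc.prems False]]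
        by (simp add: sym_coeff_mult_gen sum_distrib_left mult.left_commute flip: mult.assoc[of x])
    qed
  qed
qed

lemma matrix_coeffs_sym_coeff:
  assumes q: "q \<noteq> 0" "q \<noteq> 1" "q \<noteq> -1"
  shows "matrix_coeffs n q (sym_index n) (\<lambda>i r. r i - r (Suc i)) (sym_coeff n q)"
proof -
  have "sym_coeff n q p r x = 0" if "x \<in> uq_ideal n q" "r \<in> sym_index n" for p r x
    using that
    by induction (simp_all add: lfun_sym_coeff lfun_add lfun_zero sym_coeff_mult sym_coeff_rel q)
  then show ?thesis
    by (auto simp: matrix_coeffs_def finite_sym_index ufun_def lfun_sym_coeff sym_coeff_one
        sym_coeff_mult sym_coeff_gen gen_defs)
qed

text \<open>The exponent of \<open>x\<^sub>1 \<cdots> x\<^sub>n\<^sub>+\<^sub>1\<close>.\<close>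
definition zero_weight :: "nat \<Rightarrow> nat \<Rightarrow> int" where
  "zero_weight n k = of_bool (k \<in> {1..n + 1})"

lemma zero_weight_in: "zero_weight n \<in> sym_index n"
  by (auto simp: sym_index_def zero_weight_def)

text \<open>
  The witness sends \<open>x\<close> to the coefficient of the monomial \<open>E\<^sub>i(x\<^sub>1
  \<cdots> x\<^sub>n\<^sub>+\<^sub>1)\<close> in \<open>x(x\<^sub>1 \<cdots>
  x\<^sub>n\<^sub>+\<^sub>1)\<close>.  It lies in \<open>B\<close> because it is taken at a vector
  fixed by the \<open>K\<^sub>j\<close>, and in the kernel of the counit because it is off the
  diagonal.
\<close>
lemma ex_OBplus:
  assumes q: "q \<noteq> 0" "q \<noteq> 1" "q \<noteq> -1" and i: "i \<in> {1..n}"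
  obtains b where "b \<in> OBplus n q" "b (gE i) = 1"
proof -
  let ?r = "zero_weight n"
  let ?p = "move (GE i) ?r"
  let ?b = "sym_coeff n q ?p ?r"
  note mc = matrix_coeffs_sym_coeff[OF q, of n]
  have act: "sym_act n q (GE i) ?r = 1"
    using i qnum_1[OF q] by (simp add: zero_weight_def)
  then have p: "?p \<in> sym_index n"
    by (intro move_in_sym_index[OF zero_weight_in, of _ q]) simp
  have "?b (x * gK j) = ?b x" if "j \<in> {1..n}" for x j
    using that by (simp add: gen_defs sym_coeff_mult_gen zero_weight_def)
  moreover have "?p i \<noteq> ?r i"
    by (simp add: move_apply)
  then have "?p \<noteq> ?r" by metis
  ultimately have "?b \<in> OBplus n q"
    using matrix_coeff_in_OA[OF mc p zero_weight_in]
    by (auto simp: OBplus_def OB_def coprod_def eps_def sym_coeff_one)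
  moreover have "?b (gE i) = 1"
    using act by (simp add: gE_def sym_coeff_gen)
  ultimately show ?thesis using that by blast
qed


section \<open>The fibre of the calculus over the counit\<close>

lemma OAplus_fadd: "n \<ge> 1 \<Longrightarrow> a \<in> OAplus n q \<Longrightarrow> b \<in> OAplus n q \<Longrightarrow> fadd a b \<in> OAplus n q"
  using OA_fadd[of n a q b] by (auto simp: OAplus_def eps_def fadd_def)

lemma OAplus_fsmult: "n \<ge> 1 \<Longrightarrow> a \<in> OAplus n q \<Longrightarrow> fsmult t a \<in> OAplus n q"
  using OA_fsmult[of n a q t] by (auto simp: OAplus_def eps_def fsmult_def)

lemma OAplus_fmult: "n \<ge> 1 \<Longrightarrow> q \<noteq> 0 \<Longrightarrow> a \<in> OAplus n q \<Longrightarrow> c \<in> OA n q \<Longrightarrow> fmult a c \<in> OAplus n q"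
  using OA_fmult[of n q a c] by (auto simp: OAplus_def eps_def)

lemma OAplus_fzero: "n \<ge> 1 \<Longrightarrow> fzero \<in> OAplus n q"
  using OA_fzero[of n q] by (auto simp: OAplus_def eps_def fzero_def)

lemma OAplus_fplus:
  assumes "n \<ge> 1" "a \<in> OA n q"
  shows "fplus a \<in> OAplus n q"
proof -
  have "fplus a = fadd a (fsmult (- eps a) counit)"
    by (auto simp: fplus_def fadd_def fsmult_def)
  then have "fplus a \<in> OA n q"
    using assms OA_fadd OA_fsmult counit_in_OA by metis
  then show ?thesis
    by (simp add: OAplus_def fplus_def eps_def)
qed

lemma calc_ideal_fzero: "n \<ge> 1 \<Longrightarrow> fzero \<in> calc_ideal n q"
  using OAplus_fzero[of n q] by (auto simp: calc_ideal_def fzero_def)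

lemma calc_ideal_fadd:
  "n \<ge> 1 \<Longrightarrow> a \<in> calc_ideal n q \<Longrightarrow> b \<in> calc_ideal n q \<Longrightarrow> fadd a b \<in> calc_ideal n q"
  using OAplus_fadd[of n a q b] by (auto simp: calc_ideal_def fadd_def)

lemma calc_ideal_fsmult: "n \<ge> 1 \<Longrightarrow> a \<in> calc_ideal n q \<Longrightarrow> fsmult t a \<in> calc_ideal n q"
  using OAplus_fsmult[of n a q t] by (auto simp: calc_ideal_def fsmult_def)

text \<open>
  Every term in the coproduct of \<open>E\<^sub>j\<^sub>i\<close> has left factor \<open>1\<close>
  or some \<open>E\<^sub>k\<^sub>i\<close> with \<open>k \<le> j\<close>, and \<open>a\<close>
  vanishes at all of these.
\<close>
lemma calc_ideal_fmult:
  assumes "n \<ge> 1" "q \<noteq> 0" and a: "a \<in> calc_ideal n q" and c: "c \<in> OA n q"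
  shows "fmult a c \<in> calc_ideal n q"
  unfolding calc_ideal_def
proof (intro CollectI conjI allI impI)
  show "fmult a c \<in> OAplus n q"
    using assms by (intro OAplus_fmult) (auto simp: calc_ideal_def)
  fix i j assume ij: "1 \<le> i \<and> i < j \<and> j \<le> n + 1"
  have "ufun n q a" "ufun n q c"
    using assms OA_ufun by (auto simp: calc_ideal_def OAplus_def)
  moreover have "a 1 = 0" "\<And>k. i < k \<Longrightarrow> k \<le> n + 1 \<Longrightarrow> a (Eroot q k i) = 0"
    using a ij by (auto simp: calc_ideal_def OAplus_def eps_def)
  ultimately show "fmult a c (Eroot q j i) = 0"
    using ij by (subst fmult_Eroot) auto
qed

lemma fadd_assoc: "fadd (fadd a b) c = fadd a (fadd b c)"
  and fadd_left_commute: "fadd a (fadd b c) = fadd b (fadd a c)"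
  and fadd_fzero [simp]: "fadd fzero a = a" "fadd a fzero = a"
  and fsmult_fadd: "fsmult t (fadd a b) = fadd (fsmult t a) (fsmult t b)"
  and fsmult_fzero [simp]: "fsmult t fzero = fzero"
  and fsmult_zero [simp]: "fsmult 0 a = fzero" and fsmult_one [simp]: "fsmult 1 a = a"
  by (auto simp: fadd_def fsmult_def fzero_def algebra_simps)

lemma fmult_fadd: "fmult (fadd a b) c = fadd (fmult a c) (fmult b c)"
  and fmult_fzero [simp]: "fmult fzero c = fzero"
  unfolding fmult_def by (auto simp: fadd_def fzero_def sum.distrib algebra_simps)

lemma cls_eq: "cls n q a = (\<lambda>h. fadd h a) ` calc_ideal n q"
  by (auto simp: cls_def a_r_coset_def' func_space_def)

lemma set_add_eq: "X <+>\<^bsub>func_space S\<^esub> Y = {fadd x y | x y. x \<in> X \<and> y \<in> Y}"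
  by (auto simp: set_add_def' func_space_def)

lemma Lam_simps:
  "carrier (Lam n q) = cls n q ` OAplus n q"
  "zero (Lam n q) = calc_ideal n q"
  "add (Lam n q) X Y = {fadd x y | x y. x \<in> X \<and> y \<in> Y}"
  "smult (Lam n q) t X = {fadd h (fsmult t x) | h x. h \<in> calc_ideal n q \<and> x \<in> X}"
  "Lam_ract n q X c = {fadd h (fmult x c) | h x. h \<in> calc_ideal n q \<and> x \<in> X}"
  unfolding Lam_def quot_space_def Lam_ract_def set_add_eq
  by (auto simp: A_RCOSETS_def' func_space_def cls_def)

lemma cls_fzero: "cls n q fzero = calc_ideal n q"
  by (simp add: cls_eq)

lemma cls_self: "n \<ge> 1 \<Longrightarrow> a \<in> cls n q a"
  using calc_ideal_fzero[of n q] by (force simp: cls_eq)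

text \<open>
  The common reason why scalars and \<open>A\<close> act on classes: an additive map preserving
  the ideal induces a map on cosets.
\<close>
lemma cls_linear_image:
  assumes n: "n \<ge> 1" and add: "\<And>a b. f (fadd a b) = fadd (f a) (f b)"
    and f: "\<And>a. a \<in> calc_ideal n q \<Longrightarrow> f a \<in> calc_ideal n q"
  shows "{fadd h (f x) | h x. h \<in> calc_ideal n q \<and> x \<in> cls n q a} = cls n q (f a)"
proof -
  have "fadd h (f (fadd k a)) = fadd (fadd h (f k)) (f a)" for h k
    by (simp add: add fadd_assoc)
  then have "fadd h (f (fadd k a)) \<in> cls n q (f a)" if "h \<in> calc_ideal n q" "k \<in> calc_ideal n q" for h k
    using that calc_ideal_fadd[OF n] f by (auto simp: cls_eq)
  then show ?thesis
    using cls_self[OF n, of a q] by (auto simp: cls_eq)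
qed

lemma smult_cls: "n \<ge> 1 \<Longrightarrow> smult (Lam n q) t (cls n q a) = cls n q (fsmult t a)"
  unfolding Lam_simps by (rule cls_linear_image) (auto simp: fsmult_fadd calc_ideal_fsmult)

lemma Lam_ract_cls:
  "n \<ge> 1 \<Longrightarrow> q \<noteq> 0 \<Longrightarrow> c \<in> OA n q \<Longrightarrow> Lam_ract n q (cls n q a) c = cls n q (fmult a c)"
  unfolding Lam_simps by (rule cls_linear_image[where f = "\<lambda>x. fmult x c"]) (auto simp: fmult_fadd calc_ideal_fmult)

lemma add_cls:
  assumes n: "n \<ge> 1"
  shows "add (Lam n q) (cls n q a) (cls n q b) = cls n q (fadd a b)"
proof -
  have swap: "fadd (fadd h a) (fadd k b) = fadd (fadd h k) (fadd a b)" for h k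
    by (simp add: fadd_assoc fadd_left_commute)
  have "fadd (fadd h a) (fadd k b) \<in> cls n q (fadd a b)"
    if "h \<in> calc_ideal n q" "k \<in> calc_ideal n q" for h k
    unfolding swap cls_eq using that calc_ideal_fadd[OF n] by blast
  then have "add (Lam n q) (cls n q a) (cls n q b) \<subseteq> cls n q (fadd a b)"
    unfolding Lam_simps cls_eq[of n q a] cls_eq[of n q b] by auto
  moreover have "fadd h (fadd a b) \<in> add (Lam n q) (cls n q a) (cls n q b)"
    if "h \<in> calc_ideal n q" for h
  proof -
    have "fadd h (fadd a b) = fadd (fadd h a) (fadd fzero b)"
      by (simp add: fadd_assoc)
    with that calc_ideal_fzero[OF n, of q] show ?thesis
      unfolding Lam_simps cls_eq by blast
  qed
  then have "cls n q (fadd a b) \<subseteq> add (Lam n q) (cls n q a) (cls n q b)"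
    unfolding cls_eq[of n q "fadd a b"] by auto
  ultimately show ?thesis by (rule antisym)
qed

text \<open>
  A direct argument, from the definition of the sum as a fold, that asks for membership in the
  carrier of just the two elements involved and for no group laws.
\<close>
lemma finsum_singleton_closed:
  assumes "zero M \<in> carrier M" "add M (f k) (zero M) \<in> carrier M"
  shows "finsum M f {k} = add M (f k) (zero M)"
proof -
  let ?R = "foldSetD (carrier M) (add M \<circ> f) (zero M)"
  have "({k}, add M (f k) (zero M)) \<in> ?R"
    using foldSetD.insertI[of k "{}" "add M \<circ> f" "zero M" "carrier M" "zero M"] assms
    by (auto intro: foldSetD.emptyI)
  moreover have "y = add M (f k) (zero M)" if "({k}, y) \<in> ?R" for y
    using that
  proof cases
    case (insertI x A z)
    then have x: "x = k" and A: "A = {}" by auto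
    from insertI(5) have "z = zero M"
      unfolding A by cases auto
    with insertI x show ?thesis by auto
  qed auto
  ultimately have "(THE y. ({k}, y) \<in> ?R) = add M (f k) (zero M)"
    by blast
  then show ?thesis
    by (simp add: finsum_def finprod_def foldD_def)
qed

text \<open>
  As \<open>1\<close> is group-like, the Sweedler sum at \<open>1\<close> has a single term.  That
  this term lies in \<open>\<Lambda>\<close> has to be known for the sum to have the expected
  value.
\<close>
lemma sweedler_one:
  assumes n: "n \<ge> 1" and g: "g 1 1 = cls n q a" "a \<in> OAplus n q"
  shows "sweedler (Lam n q) 1 g = cls n q a"
proof -
  let ?M = "Lam n q"
  have cop: "cop 1 = 1"
  proof -
    have "letters 0 = []" by (simp add: zero_word_def)
    then show ?thesis by (simp add: cop_def)
  qed
  have sum: "add ?M (smult ?M 1 (g 1 1)) (zero ?M) = cls n q a"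
    by (simp add: g smult_cls[OF n] add_cls[OF n] Lam_simps(2) flip: cls_fzero)
  have "sweedler ?M 1 g = finsum ?M (\<lambda>k. smult ?M (Poly_Mapping.lookup (cop 1) k) (g (wmono (fst k)) (wmono (snd k)))) {0}"
    by (simp add: sweedler_def cop)
  also have "\<dots> = add ?M (smult ?M 1 (g 1 1)) (zero ?M)"
    using sum g(2) OAplus_fzero[OF n, of q]
    by (subst finsum_singleton_closed) (auto simp: cop Lam_simps(1,2) simp flip: cls_fzero)
  finally show ?thesis by (simp add: sum)
qed

lemma Omega_SU_simps:
  "zero (Omega_SU n q) = (\<lambda>x. zero (Lam n q))"
  "add (Omega_SU n q) = (\<lambda>f g x. add (Lam n q) (f x) (g x))"
  "smult (Omega_SU n q) = (\<lambda>c f x. smult (Lam n q) c (f x))"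
  "lact (Omega_SU n q) = first_lmult (Lam n q)"
  "ract (Omega_SU n q) = diag_rmult (Lam n q) (Lam_ract n q)"
  by (simp_all add: Omega_SU_def tensor_def fun_space_def)

lemma Omega_F_simps:
  "carrier (Omega_F n q) = Omega_F_carrier n q"
  "zero (Omega_F n q) = zero (Omega_SU n q)"
  "add (Omega_F n q) = add (Omega_SU n q)"
  "smult (Omega_F n q) = smult (Omega_SU n q)"
  "lact (Omega_F n q) = lact (Omega_SU n q)"
  "ract (Omega_F n q) = ract (Omega_SU n q)"
  by (simp_all add: Omega_F_def)

lemma lact_at_one:
  assumes "n \<ge> 1" "f 1 = cls n q a" "a \<in> OAplus n q"
  shows "lact (Omega_SU n q) b f 1 = cls n q (fsmult (b 1) a)"
  unfolding Omega_SU_simps first_lmult_def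
  using assms by (intro sweedler_one) (auto simp: smult_cls OAplus_fsmult)

lemma ract_at_one:
  assumes "n \<ge> 1" "q \<noteq> 0" "f 1 = cls n q a" "a \<in> OAplus n q" "c \<in> OA n q"
  shows "ract (Omega_SU n q) f c 1 = cls n q (fmult a c)"
  unfolding Omega_SU_simps diag_rmult_def
  using assms by (intro sweedler_one) (auto simp: Lam_ract_cls OAplus_fmult)

lemma dbar_at_one: "dbar n q b 1 = cls n q (fplus b)"
  by (simp add: dbar_def)

text \<open>
  The values at \<open>1\<close> are genuine elements of \<open>\<Lambda>\<close>, which allows
  \<open>lact_at_one\<close> and \<open>ract_at_one\<close> to be applied to all forms.
\<close>
lemma Omega_F_at_one:
  assumes n: "n \<ge> 1" and q: "q \<noteq> 0" and "f \<in> Omega_F_carrier n q"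
  shows "\<exists>a\<in>OAplus n q. f 1 = cls n q a"
  using assms(3)
proof induction
  case (dbar b)
  then show ?case
    using OAplus_fplus[OF n] by (auto simp: dbar_at_one OB_def)
next
  case (add f g)
  then show ?case
    using OAplus_fadd[OF n] by (auto simp: Omega_SU_simps add_cls[OF n])
next
  case (smult f t)
  then show ?case
    using OAplus_fsmult[OF n] by (auto simp: Omega_SU_simps smult_cls[OF n])
next
  case (lact b f)
  then show ?case
    using OAplus_fsmult[OF n] lact_at_one[OF n] by blast
next
  case (ract b f)
  then have "b \<in> OA n q" by (simp add: OB_def)
  with ract show ?case
    using OAplus_fmult[OF n q] ract_at_one[OF n q] by blast
qed

text \<open>
  Left multiplication by \<open>b\<close> acts on the fibre through the scalar
  \<open>b(1)\<close>, which is zero on \<open>B\<^sup>+\<close>.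
\<close>
lemma left_prod_at_one:
  assumes n: "n \<ge> 1" and q: "q \<noteq> 0" and "f \<in> left_prod (OBplus n q) (Omega_F n q)"
  shows "f 1 = calc_ideal n q"
  using assms(3) unfolding left_prod_def
proof induction
  case zero
  then show ?case by (simp add: Omega_F_simps Omega_SU_simps Lam_simps)
next
  case (base f)
  then obtain b g where f: "f = lact (Omega_SU n q) b g" "b 1 = 0" "g \<in> Omega_F_carrier n q"
    by (auto simp: Omega_F_simps OBplus_def eps_def)
  then show ?case
    using Omega_F_at_one[OF n q f(3)] by (auto simp: lact_at_one[OF n] cls_fzero)
next
  case (add f g)
  then show ?case
    using add_cls[OF n, of q fzero fzero] by (simp add: Omega_F_simps Omega_SU_simps cls_fzero)
next
  case (smult f c)
  then show ?case
    using smult_cls[OF n, of q c fzero] by (simp add: Omega_F_simps Omega_SU_simps cls_fzero)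
qed

text \<open>
  Of the three terms in the coproduct of \<open>E\<^sub>3\<^sub>1\<close> only the middle one
  survives: the first two vanish because \<open>b\<close> and \<open>c\<close> are zero at
  \<open>1\<close> and \<open>c\<close> is right invariant under the \<open>K\<^sub>i\<close>.
\<close>
lemma OBplus_E_product:
  assumes "n \<ge> 2" "q \<noteq> 0" and b: "b \<in> OBplus n q" "c \<in> OBplus n q"
  shows "fmult b c (Eroot q 3 1) = (1 - inverse (of_real q) ^ 2) * (b (gE 1) * c (gE 2))"
proof -
  have u: "ufun n q b" "ufun n q c"
    using assms OA_ufun[of n] by (auto simp: OBplus_def OB_def)
  have K: "c (x * gK i) = c x" if "i \<in> {1..n}" for x i
    using b(2) that by (auto simp: OBplus_def OB_def coprod_def dest: fun_cong)
  have one: "b 1 = 0" "c 1 = 0"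
    using b by (auto simp: OBplus_def eps_def)
  have kp: "Kprod 1 2 = gK 1" "Kprod 1 3 = gK 1 * gK 2"
    by (simp_all add: numeral_2_eq_2 numeral_3_eq_3)
  have er: "Eroot q 2 1 = gE 1" "Eroot q 3 2 = gE 2"
    using Eroot_simple[of q 1] Eroot_simple[of q 2] by (simp_all add: eval_nat_numeral)
  have S: "{1<..<3} = {2::nat}" by auto
  have "c (Kprod 1 3) = 0"
    unfolding kp using K[of 2 "gK 1"] K[of 1 1] assms(1) one by simp
  have "fmult b c (Eroot q 3 1)
      = (1 - inverse (of_real q) ^ 2) * (b (Eroot q 2 1) * c (Eroot q 3 2 * Kprod 1 2))"
    using fmult_Eroot[of 1 3 n q b c] u assms(1) one \<open>c (Kprod 1 3) = 0\<close> unfolding S by simp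
  then show ?thesis
    using K[of 1 "gE 2"] assms(1) by (simp only: er kp) simp
qed


section \<open>The two products differ\<close>

theorem proposition5p9:
  fixes n :: nat and q :: real
  assumes "n \<ge> 2" and "q \<noteq> -1" and "q \<noteq> 0" and "q \<noteq> 1"
  shows "\<not> in_ABMod0 n q (Omega_F n q) \<and>
    left_prod (OBplus n q) (Omega_F n q) \<noteq> right_prod (Omega_F n q) (OBplus n q)"
proof -
  have n: "n \<ge> 1" and i: "1 \<in> {1..n}" "2 \<in> {1..n}"
    using assms(1) by auto
  obtain b where b: "b \<in> OBplus n q" "b (gE 1) = 1"
    by (rule ex_OBplus[OF assms(3,4,2) i(1)])
  obtain c where c: "c \<in> OBplus n q" "c (gE 2) = 1"
    by (rule ex_OBplus[OF assms(3,4,2) i(2)])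
  let ?f = "dbar n q b"
  let ?g = "ract (Omega_F n q) ?f c"
  have mem: "b \<in> OB n q" "b \<in> OAplus n q" "c \<in> OA n q"
    using b(1) c(1) by (auto simp: OBplus_def OB_def OAplus_def)
  have "fplus b = b"
    using b(1) by (simp add: fplus_def OBplus_def)
  then have "?f 1 = cls n q b"
    by (simp add: dbar_at_one)
  then have g: "?g 1 = cls n q (fmult b c)"
    unfolding Omega_F_simps by (rule ract_at_one[OF n assms(3) _ mem(2,3)])
  have "?f \<in> carrier (Omega_F n q)"
    using Omega_F_carrier.dbar[OF mem(1)] by (simp add: Omega_F_simps)
  then have "?g \<in> right_prod (Omega_F n q) (OBplus n q)"
    unfolding right_prod_def using c(1) by (blast intro: lin_span.base)
  moreover have "?g \<notin> left_prod (OBplus n q) (Omega_F n q)"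
  proof
    assume "?g \<in> left_prod (OBplus n q) (Omega_F n q)"
    then have "fmult b c \<in> calc_ideal n q"
      using left_prod_at_one[OF n assms(3)] cls_self[OF n, of "fmult b c" q] g by simp
    then have "fmult b c (Eroot q 3 1) = 0"
      using assms(1) by (simp add: calc_ideal_def)
    then have "inverse (complex_of_real q) ^ 2 = 1"
      using OBplus_E_product[OF assms(1,3) b(1) c(1)] b(2) c(2) by simp
    then show False
      using q_minus_inverse_nonzero[OF assms(3,4,2)] assms(3)
      by (simp add: field_simps power2_eq_square)
  qed
  ultimately show ?thesis
    unfolding in_ABMod0_def by blast
qed

end
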